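(* There is an assignment $\Gamma \mapsto P_\Gamma$, associating to every graph $\Gamma=(V,E)$ a plane $P_\Gamma$, such that: (1) if $\Gamma$ is finite, then $P_\Gamma$ has size $3|V|+|E|+17$; (2) if $\Gamma$ is infinite, then $P_\Gamma$ has the same size as $\Gamma$; (3) except for $17$ points, every point of $P_\Gamma$ is incident with at most two non-trivial lines; (4) $\mathrm{Aut}(\Gamma)\cong \mathrm{Aut}(P_\Gamma)$; (5) for all graphs $\Gamma_1,\Gamma_2$: $\Gamma_1\cong\Gamma_2$ if and only if $P_{\Gamma_1}\cong P_{\Gamma_2}$; (6) restricted to structures with domain $\omega$, the map $\Gamma\mapsto P_\Gamma$ is Borel (with respect to the naturally associated Polish topologies).
   Context: Graphs are simple and undirected: $V$ is the set of vertices and $E$ is a set of two-element subsets of $V$. The size of an infinite graph is $|V|$. A plane is a system of points and lines (lines being regarded as sets of points) such that: (A) every pair of distinct points determines a unique line (i.e. lies on exactly one common line); (B) every pair of distinct lines intersects in at most one point; (C) every line contains at least two points; (D) there exist at least three non-collinear points. The size $|P|$ of a plane $P$ is the cardinality of its set of points. A point and a line are incident if the point is contained in the line. A line is trivial if it is incident with exactly two points, and non-trivial otherwise. Isomorphisms (and automorphisms) of planes are bijections of points and lines preserving incidence and non-incidence. Item (6) is in the sense of invariant descriptive set theory. Graphs with domain $\omega$ are structures in the language with one binary relation symbol. Planes with domain $\omega$ are structures in a relational language specifying points, lines (e.g. two unary predicates partitioning the domain) and the point-line incidence relation. For a countable relational language $L$, the space of $L$-structures with domain $\omega$ is identified with $\prod_{R\in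 L}2^{\omega^{n_R}}$ ($n_R$ the arity of $R$) with the product topology. Item (6) says that for $\Gamma$ with domain $\omega$ the plane $P_\Gamma$ is realised as a structure with domain $\omega$ in such a way that the resulting map is Borel. *)

theory Defs
  imports "HOL-Analysis.Analysis" "HOL-Algebra.Bij" "HOL-Library.Equipollence"
begin

record 'v graph =
  verts :: "'v set"
  edges :: "'v set set"

definition is_graph :: "'v graph \<Rightarrow> bool" where
  "is_graph G \<longleftrightarrow> (\<forall>e\<in>edges G. e \<subseteq> verts G \<and> card e = 2)"

definition graph_iso :: "('v \<Rightarrow> 'w) \<Rightarrow> 'v graph \<Rightarrow> 'w graph \<Rightarrow> bool" where
  "graph_iso f G H \<longleftrightarrow>
     bij_betw f (verts G) (verts H) \<and>
     (\<forall>x\<in>verts G. \<forall>y\<in>verts G. {x, y} \<in> edges G \<longleftrightarrow> {f x, f y} \<in> edges H)"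

definition graphs_isomorphic :: "'v graph \<Rightarrow> 'w graph \<Rightarrow> bool" where
  "graphs_isomorphic G H \<longleftrightarrow> (\<exists>f. graph_iso f G H)"

definition Aut_graph :: "'v graph \<Rightarrow> ('v \<Rightarrow> 'v) monoid" where
  "Aut_graph G =
     BijGroup (verts G) \<lparr>carrier := {f \<in> Bij (verts G). graph_iso f G G}\<rparr>"

record 'p plane =
  points :: "'p set"
  lines :: "'p set set"

definition is_plane :: "'p plane \<Rightarrow> bool" where
  "is_plane P \<longleftrightarrow>
     (\<forall>l\<in>lines P. l \<subseteq> points P) \<and>
     (\<forall>p\<in>points P. \<forall>q\<in>points P. p \<noteq> q \<longrightarrow> (\<exists>!l. l \<in> lines P \<and> p \<in> l \<and> q \<in> l)) \<and>
     (\<forall>l\<in>lines P. \<forall>m\<in>lines P. l \<noteq> m \<longrightarrow> (\<forall>p\<in>l \<inter> m. \<forall>q\<in>l \<inter> m. p = q)) \<and>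
     (\<forall>l\<in>lines P. \<exists>p\<in>l. \<exists>q\<in>l. p \<noteq> q) \<and>
     (\<exists>p\<in>points P. \<exists>q\<in>points P. \<exists>r\<in>points P.
        p \<noteq> q \<and> p \<noteq> r \<and> q \<noteq> r \<and> \<not> (\<exists>l\<in>lines P. p \<in> l \<and> q \<in> l \<and> r \<in> l))"

definition trivial_line :: "'p set \<Rightarrow> bool" where
  "trivial_line l \<longleftrightarrow> card l = 2"

definition nontrivial_lines_through :: "'p plane \<Rightarrow> 'p \<Rightarrow> 'p set set" where
  "nontrivial_lines_through P p = {l \<in> lines P. p \<in> l \<and> \<not> trivial_line l}"

definition plane_iso ::
    "('p \<Rightarrow> 'q) \<Rightarrow> ('p set \<Rightarrow> 'q set) \<Rightarrow> 'p plane \<Rightarrow> 'q plane \<Rightarrow> bool" where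
  "plane_iso f g P Q \<longleftrightarrow>
     bij_betw f (points P) (points Q) \<and>
     bij_betw g (lines P) (lines Q) \<and>
     (\<forall>p\<in>points P. \<forall>l\<in>lines P. p \<in> l \<longleftrightarrow> f p \<in> g l)"

definition planes_isomorphic :: "'p plane \<Rightarrow> 'q plane \<Rightarrow> bool" where
  "planes_isomorphic P Q \<longleftrightarrow> (\<exists>f g. plane_iso f g P Q)"

definition Aut_plane :: "'p plane \<Rightarrow> (('p \<Rightarrow> 'p) \<times> ('p set \<Rightarrow> 'p set)) monoid" where
  "Aut_plane P =
     (BijGroup (points P) \<times>\<times> BijGroup (lines P))
       \<lparr>carrier := {(f, g). f \<in> Bij (points P) \<and> g \<in> Bij (lines P) \<and> plane_iso f g P P}\<rparr>"

text \<open>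
  Structures with domain \<open>\<omega>\<close>. A symbol of arity \<open>n\<close> is interpreted by a point of
  \<open>2 ^ (\<omega> ^ n)\<close>; the library topology on \<open>bool\<close> is discrete and the one on functions and
  pairs is the product topology, so \<^term>\<open>borel\<close> on the types below is the Borel
  \<open>\<sigma>\<close>-algebra of the space of structures.
\<close>

type_synonym omega_graph = "nat \<times> nat \<Rightarrow> bool"

definition omega_graphs :: "omega_graph set" where
  "omega_graphs = {R. (\<forall>m. \<not> R (m, m)) \<and> (\<forall>m n. R (m, n) \<longrightarrow> R (n, m))}"

text \<open>
  The graph coded by \<open>R\<close>, with \<open>\<omega>\<close> copied into the type of vertices by an injection \<open>e\<close>.
\<close>

definition graph_of_omega :: "(nat \<Rightarrow> 'v) \<Rightarrow> omega_graph \<Rightarrow> 'v graph" where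
  "graph_of_omega e R = \<lparr>verts = range e, edges = {{e m, e n} | m n. R (m, n)}\<rparr>"

text \<open>
  The components interpret, in this order, ``is a point'', ``is a line'' and ``is incident with''.
\<close>

type_synonym omega_plane = "(nat \<Rightarrow> bool) \<times> (nat \<Rightarrow> bool) \<times> (nat \<times> nat \<Rightarrow> bool)"

fun realises :: "omega_plane \<Rightarrow> 'p plane \<Rightarrow> bool" where
  "realises (Pt, Li, In) P \<longleftrightarrow>
     (\<forall>n. Pt n \<longleftrightarrow> \<not> Li n) \<and>
     (\<forall>m n. In (m, n) \<longrightarrow> Pt m \<and> Li n) \<and>
     (\<exists>f g. bij_betw f (points P) {n. Pt n} \<and> bij_betw g (lines P) {n. Li n} \<and>
       (\<forall>p\<in>points P. \<forall>l\<in>lines P. p \<in> l \<longleftrightarrow> In (f p, g l)))"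

end

theory Submission
  imports Defs
begin

text \<open>
  The non-trivial lines of \<open>P\<^sub>\<Gamma>\<close> are prescribed and every other pair of points is joined by a trivial
  line. There are 17 base points, three points per vertex and one per edge. A star line for
  every vertex \<open>v\<close> carries the three points of \<open>v\<close> and the edges at \<open>v\<close>, so that stars
  of adjacent vertices meet in the point of the edge. Three rails each carry three base points and one
  point of every vertex, and the strips \<open>{i, i + 1, i + 3}\<close> carry base points only. Points off
  the base lie on exactly two non-trivial lines, whereas the base points 0 and 4 are the only ones
  of valency 1 and 6. Hence they are preserved by every isomorphism; repeatedly taking the third
  point of a strip shows that all base points are. Then rails go to rails and stars to
  stars, and the isomorphism comes from a unique isomorphism of graphs. For Borel measurability, points
  and lines receive natural numbers as codes such that being a code in use, and incidence of coded
  objects, are Borel conditions on \<open>\<Gamma>\<close>; the codes in use are then enumerated increasingly.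
\<close>

section \<open>Planes with prescribed non-trivial lines\<close>

definition plane_of_blocks :: "'p set \<Rightarrow> 'p set set \<Rightarrow> 'p plane" where
  "plane_of_blocks X N = \<lparr>points = X, lines = N \<union>
     {{p, q} | p q. p \<in> X \<and> q \<in> X \<and> p \<noteq> q \<and> \<not> (\<exists>l\<in>N. p \<in> l \<and> q \<in> l)}\<rparr>"

lemma points_plane_of_blocks [simp]: "points (plane_of_blocks X N) = X"
  by (simp add: plane_of_blocks_def)

lemma lines_plane_of_blocks:
  "l \<in> lines (plane_of_blocks X N) \<longleftrightarrow> l \<in> N \<or>
    (\<exists>p q. l = {p, q} \<and> p \<in> X \<and> q \<in> X \<and> p \<noteq> q \<and> \<not> (\<exists>l\<in>N. p \<in> l \<and> q \<in> l))"
  by (auto simp: plane_of_blocks_def)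

lemma block_in_lines: "l \<in> N \<Longrightarrow> l \<in> lines (plane_of_blocks X N)"
  by (simp add: plane_of_blocks_def)

lemma pair_in_lines:
  assumes "p \<in> X" "q \<in> X" "p \<noteq> q" "\<not> (\<exists>l\<in>N. p \<in> l \<and> q \<in> l)"
  shows "{p, q} \<in> lines (plane_of_blocks X N)"
  unfolding lines_plane_of_blocks using assms by (intro disjI2 exI[of _ p] exI[of _ q]) simp

lemma joining_line:
  assumes "p \<in> X" "q \<in> X" "p \<noteq> q"
  shows "\<exists>l\<in>lines (plane_of_blocks X N). p \<in> l \<and> q \<in> l"
proof (cases "\<exists>l\<in>N. p \<in> l \<and> q \<in> l")
  case True
  then show ?thesis using block_in_lines by metis
next
  case False
  then have "{p, q} \<in> lines (plane_of_blocks X N)"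
    using assms by (intro pair_in_lines)
  then show ?thesis by (intro bexI[of _ "{p, q}"]) simp_all
qed

text \<open>Points of an added pair share no block, so neither a block nor a different added pair
  can contain both of them; only two blocks meeting twice must be excluded by hypothesis. Likewise
  three distinct points never fit into an added pair, so for the triple only blocks have to be
  considered.\<close>

lemma is_plane_plane_of_blocks:
  assumes sub: "\<And>l. l \<in> N \<Longrightarrow> l \<subseteq> X"
    and two: "\<And>l. l \<in> N \<Longrightarrow> \<exists>p\<in>l. \<exists>q\<in>l. p \<noteq> q"
    and meet: "\<And>l m p q. \<lbrakk>l \<in> N; m \<in> N; p \<in> l; q \<in> l; p \<in> m; q \<in> m; p \<noteq> q\<rbrakk> \<Longrightarrow> l = m"
    and tri: "p \<in> X" "q \<in> X" "r \<in> X" "p \<noteq> q" "p \<noteq> r" "q \<noteq> r"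
      "\<And>l. \<lbrakk>l \<in> N; p \<in> l; q \<in> l\<rbrakk> \<Longrightarrow> r \<notin> l"
  shows "is_plane (plane_of_blocks X N)"
proof -
  let ?L = "lines (plane_of_blocks X N)"
  have unique: "l = m"
    if "l \<in> ?L" "m \<in> ?L" "p \<in> l" "q \<in> l" "p \<in> m" "q \<in> m" "p \<noteq> q" for l m p q
    using that meet[of l m p q] unfolding lines_plane_of_blocks by auto
  have nocol: "\<not> (\<exists>l\<in>?L. p \<in> l \<and> q \<in> l \<and> r \<in> l)"
    using tri(4-7) by (auto simp: lines_plane_of_blocks)
  show ?thesis
    unfolding is_plane_def points_plane_of_blocks
  proof (intro conjI ballI impI)
    show "l \<subseteq> X" if "l \<in> ?L" for l
      using that sub unfolding lines_plane_of_blocks by auto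
    show "\<exists>!l. l \<in> ?L \<and> p \<in> l \<and> q \<in> l" if "p \<in> X" "q \<in> X" "p \<noteq> q" for p q
      using joining_line[OF that] unique that(3) by metis
    show "p = q" if "l \<in> ?L" "m \<in> ?L" "l \<noteq> m" "p \<in> l \<inter> m" "q \<in> l \<inter> m" for l m p q
      using unique that by blast
    show "\<exists>p\<in>l. \<exists>q\<in>l. p \<noteq> q" if "l \<in> ?L" for l
    proof (cases "l \<in> N")
      case True
      then show ?thesis by (rule two)
    next
      case False
      with that obtain p q where "l = {p, q}" "p \<noteq> q" unfolding lines_plane_of_blocks by auto
      then show ?thesis by (intro bexI[of _ p] bexI[of _ q]) simp_all
    qed
    show "\<exists>p\<in>X. \<exists>q\<in>X. \<exists>r\<in>X. p \<noteq> q \<and> p \<noteq> r \<and> q \<noteq> r \<and>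
            \<not> (\<exists>l\<in>?L. p \<in> l \<and> q \<in> l \<and> r \<in> l)"
      using tri(1-6) nocol
      by (intro bexI[of _ p] bexI[of _ q] bexI[of _ r] conjI)
  qed
qed

lemma nontrivial_lines_plane_of_blocks:
  assumes "\<And>l. l \<in> N \<Longrightarrow> card l \<noteq> 2"
  shows "l \<in> lines (plane_of_blocks X N) \<and> \<not> trivial_line l \<longleftrightarrow> l \<in> N"
proof (cases "l \<in> N")
  case True
  then show ?thesis using assms[OF True] by (simp add: lines_plane_of_blocks trivial_line_def)
next
  case False
  then have "trivial_line l" if "l \<in> lines (plane_of_blocks X N)"
    using that unfolding lines_plane_of_blocks trivial_line_def card_2_iff by blast
  then show ?thesis using False by blast
qed

lemma nontrivial_lines_through_plane_of_blocks:
  assumes "\<And>l. l \<in> N \<Longrightarrow> card l \<noteq> 2"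
  shows "nontrivial_lines_through (plane_of_blocks X N) p = {l \<in> N. p \<in> l}"
  using nontrivial_lines_plane_of_blocks[OF assms] unfolding nontrivial_lines_through_def by blast

text \<open>Replaces the quantifier over all lines by one over blocks and a condition on points. In
  this form collinearity is later shown to be a Borel condition.\<close>

lemma collinear_plane_of_blocks:
  assumes "\<And>l. l \<in> N \<Longrightarrow> l \<subseteq> X" "p \<noteq> q"
  shows "(\<exists>l\<in>lines (plane_of_blocks X N). p \<in> l \<and> q \<in> l \<and> r \<in> l) \<longleftrightarrow>
    (\<exists>l\<in>N. p \<in> l \<and> q \<in> l \<and> r \<in> l) \<or> p \<in> X \<and> q \<in> X \<and> (r = p \<or> r = q)"
  (is "?l \<longleftrightarrow> ?r")
proof
  assume ?l
  then obtain l where l: "l \<in> lines (plane_of_blocks X N)" "p \<in> l" "q \<in> l" "r \<in> l" by blast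
  show ?r
  proof (cases "l \<in> N")
    case True
    then show ?thesis using l by blast
  next
    case False
    then obtain a b where "l = {a, b}" "a \<in> X" "b \<in> X"
      using l(1) unfolding lines_plane_of_blocks by auto
    then show ?thesis using l(2-4) assms(2) by auto
  qed
next
  assume ?r
  then show ?l
    using block_in_lines[of _ N X] joining_line[of p X q N] assms(2) by metis
qed


section \<open>The plane of a graph\<close>

text \<open>The differences 1, 2 and 3 within \<open>{0, 1, 3}\<close> are distinct (a Golomb
  ruler), so two different translates share at most one point.\<close>

definition strip :: "nat \<Rightarrow> ('v set \<times> nat) set" where
  "strip i = {({}, i), ({}, i + 1), ({}, i + 3)}"

text \<open>
  Base points on a common strip differ by 1, 2 or 3, those on a common rail by 4 or more.
\<close>

definition rail :: "'v graph \<Rightarrow> nat \<Rightarrow> ('v set \<times> nat) set" where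
  "rail G k = {({}, 4), ({}, 8 + k), ({}, 14 + k)} \<union> (\<lambda>v. ({v}, k)) ` verts G"

text \<open>The three points of \<open>v\<close> keep its star non-trivial even if \<open>v\<close>
  is isolated, and each of them lies on one rail. An edge point \<open>(e, 0)\<close> cannot clash
  with a vertex point, as \<open>e\<close> has two elements.\<close>

definition star :: "'v graph \<Rightarrow> 'v \<Rightarrow> ('v set \<times> nat) set" where
  "star G v = (\<lambda>k. ({v}, k)) ` {..<3} \<union> (\<lambda>e. (e, 0)) ` {e \<in> edges G. v \<in> e}"

definition blocks :: "'v graph \<Rightarrow> ('v set \<times> nat) set set" where
  "blocks G = strip ` {..<14} \<union> rail G ` {..<3} \<union> star G ` verts G"

definition base :: "('v set \<times> nat) set" where
  "base = (\<lambda>i. ({}, i)) ` {..<17}"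

text \<open>
  First components have 0, 1 or 2 elements for base points, points of vertices and edges.
\<close>

definition pts :: "'v graph \<Rightarrow> ('v set \<times> nat) set" where
  "pts G = base \<union> (\<lambda>v. {v}) ` verts G \<times> {..<3} \<union> (\<lambda>e. (e, 0)) ` edges G"

definition graph_plane :: "'v graph \<Rightarrow> ('v set \<times> nat) plane" where
  "graph_plane G = plane_of_blocks (pts G) (blocks G)"

section \<open>Membership tests and intersections of blocks\<close>

lemma in_strip: "(s, n) \<in> strip i \<longleftrightarrow> s = {} \<and> (n = i \<or> n = i + 1 \<or> n = i + 3)"
  by (auto simp: strip_def)

lemma in_rail: "(s, n) \<in> rail G k \<longleftrightarrow>
    s = {} \<and> (n = 4 \<or> n = 8 + k \<or> n = 14 + k) \<or> (\<exists>v\<in>verts G. s = {v} \<and> n = k)"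
  by (auto simp: rail_def)

lemma in_star: "(s, n) \<in> star G v \<longleftrightarrow> s = {v} \<and> n < 3 \<or> n = 0 \<and> s \<in> edges G \<and> v \<in> s"
  by (auto simp: star_def)

lemma in_base: "(s, n) \<in> base \<longleftrightarrow> s = {} \<and> n < 17"
  by (auto simp: base_def)

lemma in_pts: "(s, n) \<in> pts G \<longleftrightarrow>
    s = {} \<and> n < 17 \<or> (\<exists>v\<in>verts G. s = {v} \<and> n < 3) \<or> n = 0 \<and> s \<in> edges G"
  by (auto simp: pts_def base_def)

lemma edge_cases:
  assumes "is_graph G" "e \<in> edges G"
  obtains u v where "e = {u, v}" "u \<noteq> v" "u \<in> verts G" "v \<in> verts G"
  using assms unfolding is_graph_def by (auto simp: card_2_iff)

lemma edge_eq:
  assumes "is_graph G" "e \<in> edges G" "u \<in> e" "v \<in> e" "u \<noteq> v"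
  shows "e = {u, v}"
  using edge_cases[OF assms(1,2)] assms(3-5) by blast

lemma edge_not:
  assumes "is_graph G"
  shows "{} \<notin> edges G" "{v} \<notin> edges G"
  using assms unfolding is_graph_def by fastforce+

lemma block_cases [consumes 1]:
  assumes "l \<in> blocks G"
  obtains i where "i < 14" "l = strip i"
    | k where "k < 3" "l = rail G k"
    | v where "v \<in> verts G" "l = star G v"
  using assms unfolding blocks_def by blast

lemma strip_determined:
  fixes a b i j :: nat
  assumes "a = i \<or> a = i + 1 \<or> a = i + 3" "b = i \<or> b = i + 1 \<or> b = i + 3"
    and "a = j \<or> a = j + 1 \<or> a = j + 3" "b = j \<or> b = j + 1 \<or> b = j + 3" and "a \<noteq> b"
  shows "i = j"
  using assms by (elim disjE; simp)

text \<open>At least one of \<open>a\<close> and \<open>b\<close> is not the common point 4. It lies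
  in one of the disjoint ranges 8 to 10 and 14 to 16, each of which lists the three rails in order,
  so the rail can be read off.\<close>

lemma rail_determined:
  fixes a b i j :: nat
  assumes "a = 4 \<or> a = 8 + i \<or> a = 14 + i" "b = 4 \<or> b = 8 + i \<or> b = 14 + i"
    and "a = 4 \<or> a = 8 + j \<or> a = 14 + j" "b = 4 \<or> b = 8 + j \<or> b = 14 + j"
    and "a \<noteq> b" "i < 3" "j < 3"
  shows "i = j"
  using assms by (elim disjE; simp)

text \<open>First components keep strips and stars disjoint. Base points are at most 3 apart on a
  strip and at least 4 apart on a rail. Rail \<open>k\<close> and the star of \<open>v\<close> share
  at most \<open>({v}, k)\<close>, two rails only the base point 4, and two stars at most the point
  of an edge.\<close>

lemma blocks_meet:
  assumes G: "is_graph G" and lm: "l \<in> blocks G" "m \<in> blocks G"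
    and pq: "p \<in> l" "q \<in> l" "p \<in> m" "q \<in> m" "p \<noteq> q"
  shows "l = m"
proof -
  obtain s a t b where [simp]: "p = (s, a)" "q = (t, b)" by fastforce
  note mem = in_strip in_rail in_star edge_not[OF G]
  have strip_rail: False if "p \<in> strip i" "q \<in> strip i" "p \<in> rail G k" "q \<in> rail G k" "k < 3" for i k
    using that pq(5) by (auto simp: mem)
  have strip_star: False if "p \<in> strip i" "p \<in> star G v" for i v
    using that by (auto simp: mem)
  have rail_star: False
    if "p \<in> rail G k" "q \<in> rail G k" "p \<in> star G v" "q \<in> star G v" for k v
    using that pq(5) by (auto simp: mem)
  have strips: "i = j" if "p \<in> strip i" "q \<in> strip i" "p \<in> strip j" "q \<in> strip j" for i j
    using strip_determined[of a i b j] that pq(5) by (simp add: mem)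
  have rails: "j = k"
    if "p \<in> rail G j" "q \<in> rail G j" "p \<in> rail G k" "q \<in> rail G k" "j < 3" "k < 3" for j k
  \<comment> \<open>A vertex point on a rail carries the index of that rail as its second component,
    so the arithmetic is needed for two base points only.\<close>
  proof (cases "s = {} \<and> t = {}")
    case True
    then show ?thesis using rail_determined[of a j b k] that pq(5) by (simp add: mem)
  next
    case False
    then show ?thesis using that(1-4) by (auto simp: mem)
  qed
  have stars: "u = v"
    if "p \<in> star G u" "q \<in> star G u" "p \<in> star G v" "q \<in> star G v" for u v
  proof (rule ccontr)
    assume "u \<noteq> v"
    with that have "s = {u, v} \<and> a = 0" "t = {u, v} \<and> b = 0"
      by (auto simp: mem dest: edge_eq[OF G])
    with pq(5) show False by simp
  qed
  from lm(1) show ?thesis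
  proof (cases rule: block_cases)
    case (1 i)
    from lm(2) show ?thesis
      by (cases rule: block_cases) (use 1 pq(1-4) strips strip_rail strip_star in blast)+
  next
    case (2 k)
    from lm(2) show ?thesis
      by (cases rule: block_cases) (use 2 pq(1-4) rails strip_rail rail_star in blast)+
  next
    case (3 v)
    from lm(2) show ?thesis
      by (cases rule: block_cases) (use 3 pq(1-4) stars strip_star rail_star in blast)+
  qed
qed

lemma blocks_subset:
  assumes "l \<in> blocks G"
  shows "l \<subseteq> pts G"
  using assms
  by (cases rule: block_cases) (auto simp: in_strip in_rail in_star in_pts)

text \<open>Three named points also settle the case of an infinite \<open>l\<close>, where
  \<open>card l = 0\<close>; rails and stars of infinite graphs can be infinite.\<close>

lemma three_points_card:
  assumes "a \<in> l" "b \<in> l" "c \<in> l" "a \<noteq> b" "a \<noteq> c" "b \<noteq> c"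
  shows "card l \<noteq> 2"
  using assms by (auto simp: card_2_iff)

lemma blocks_card:
  assumes "l \<in> blocks G"
  shows "card l \<noteq> 2"
  using assms
proof (cases rule: block_cases)
  case (1 i)
  then show ?thesis
    using three_points_card[of "({}, i)" l "({}, i + 1)" "({}, i + 3)"] by (simp add: in_strip)
next
  case (2 k)
  then show ?thesis
    using three_points_card[of "({}, 4)" l "({}, 8 + k)" "({}, 14 + k)"] by (simp add: in_rail)
next
  case (3 v)
  then show ?thesis
    using three_points_card[of "({v}, 0)" l "({v}, 1)" "({v}, 2)"] by (simp add: in_star)
qed

lemma blocks_two_points:
  assumes "l \<in> blocks G"
  shows "\<exists>p\<in>l. \<exists>q\<in>l. p \<noteq> q"
proof -
  have two: "\<exists>p\<in>l. \<exists>q\<in>l. p \<noteq> q" if "p \<in> l" "q \<in> l" "p \<noteq> q" for p q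
    using that by blast
  from assms show ?thesis
  proof (cases rule: block_cases)
    case (1 i)
    then show ?thesis by (intro two[of "({}, i)" "({}, i + 1)"]) (simp_all add: in_strip)
  next
    case (2 k)
    then show ?thesis by (intro two[of "({}, 4)" "({}, 8 + k)"]) (simp_all add: in_rail)
  next
    case (3 v)
    then show ?thesis by (intro two[of "({v}, 0)" "({v}, 1)"]) (simp_all add: in_star)
  qed
qed

lemma points_graph_plane [simp]: "points (graph_plane G) = pts G"
  by (simp add: graph_plane_def)

lemma is_plane_graph_plane:
  assumes G: "is_graph G"
  shows "is_plane (graph_plane G)"
  unfolding graph_plane_def
proof (rule is_plane_plane_of_blocks)
  \<comment> \<open>The only block through 0 is \<open>strip 0\<close>, which omits 2. The triple
    consists of base points, so it serves the empty graph as well.\<close>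
  show "({}, 0) \<in> pts G" "({}, 1) \<in> pts G" "({}, 2) \<in> pts G" by (auto simp: in_pts)
  show "({}, 2) \<notin> l" if "l \<in> blocks G" "({}, 0) \<in> l" "({}, 1) \<in> l" for l
    using that by (cases rule: block_cases) (simp_all add: in_strip in_rail in_star)
  show "l = m" if "l \<in> blocks G" "m \<in> blocks G" "p \<in> l" "q \<in> l" "p \<in> m" "q \<in> m" "p \<noteq> q" for l m p q
    using blocks_meet[OF G that] .
  show "l \<subseteq> pts G" "\<exists>p\<in>l. \<exists>q\<in>l. p \<noteq> q" if "l \<in> blocks G" for l
    using blocks_subset[OF that] blocks_two_points[OF that] by blast+
qed simp_all

lemma nontrivial_graph_plane:
  "nontrivial_lines_through (graph_plane G) p = {l \<in> blocks G. p \<in> l}"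
  unfolding graph_plane_def using blocks_card by (rule nontrivial_lines_through_plane_of_blocks)

lemma block_iff:
  "l \<in> blocks G \<longleftrightarrow> l \<in> lines (graph_plane G) \<and> \<not> trivial_line l"
  using nontrivial_lines_plane_of_blocks[of "blocks G" l "pts G"] blocks_card
  unfolding graph_plane_def by blast


section \<open>Cardinality\<close>

lemma card_pts:
  assumes G: "is_graph G" and fin: "finite (verts G)"
  shows "finite (pts G) \<and> card (pts G) = 3 * card (verts G) + card (edges G) + 17"
proof -
  let ?V = "(\<lambda>v. {v}) ` verts G \<times> {..<3::nat}" and ?E = "(\<lambda>e. (e, 0::nat)) ` edges G"
  have "edges G \<subseteq> Pow (verts G)" using G by (auto simp: is_graph_def)
  then have finE: "finite (edges G)" using fin by (meson finite_Pow_iff finite_subset)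
  have b: "card (base :: ('a set \<times> nat) set) = 17" "finite (base :: ('a set \<times> nat) set)"
    unfolding base_def by (auto simp: card_image inj_on_def)
  have v: "card ?V = 3 * card (verts G)" "finite ?V"
    using fin by (auto simp: card_cartesian_product card_image)
  have e: "card ?E = card (edges G)" "finite ?E"
    using finE by (auto simp: card_image inj_on_def)
  have "base \<inter> ?V = {}" by (auto simp: base_def)
  then have "card (base \<union> ?V) = 17 + 3 * card (verts G)" "finite (base \<union> ?V)"
    using b v by (simp_all add: card_Un_disjoint)
  moreover have "(base \<union> ?V) \<inter> ?E = {}" using edge_not[OF G] by (auto simp: base_def)
  ultimately show ?thesis
    unfolding pts_def using e by (simp add: card_Un_disjoint)
qed

lemma Un_lepoll_infinite:
  assumes "infinite C" "A \<lesssim> C" "B \<lesssim> C"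
  shows "A \<union> B \<lesssim> C"
  using assms card_of_Un_ordLeq_infinite_Field[OF _ _ _ card_of_Card_order, of C A B]
  by (simp add: lepoll_def card_of_ordLeq Field_card_of)

text \<open>For the upper bound, an infinite set is equipotent with its square. The edges lie in an
  image of the square of the vertex set, and the vertex points embed into it.\<close>

lemma eqpoll_pts:
  assumes G: "is_graph G" and inf: "infinite (verts G)"
  shows "pts G \<approx> verts G"
proof (rule lepoll_antisym)
  have "(\<lambda>v. ({v}, 0)) ` verts G \<subseteq> pts G" by (auto simp: in_pts)
  then show "verts G \<lesssim> pts G" by (auto simp: lepoll_def intro!: exI[of _ "\<lambda>v. ({v}, 0)"] inj_onI)
  have sq: "verts G \<times> verts G \<lesssim> verts G"
    using card_of_Times_same_infinite[OF inf]
    by (intro eqpoll_imp_lepoll) (simp add: eqpoll_iff_card_of_ordIso)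
  have "edges G \<subseteq> (\<lambda>(u, v). {u, v}) ` (verts G \<times> verts G)"
  proof
    fix e assume "e \<in> edges G"
    then obtain u v where "e = {u, v}" "u \<in> verts G" "v \<in> verts G" by (rule edge_cases[OF G])
    then show "e \<in> (\<lambda>(u, v). {u, v}) ` (verts G \<times> verts G)"
      by (intro image_eqI[of _ _ "(u, v)"]) simp_all
  qed
  then have "edges G \<lesssim> verts G"
    using sq by (meson image_lepoll lepoll_trans subset_imp_lepoll)
  then have E: "(\<lambda>e. (e, 0::nat)) ` edges G \<lesssim> verts G"
    by (meson image_lepoll lepoll_trans)
  have V: "(\<lambda>v. {v}) ` verts G \<times> {..<3::nat} \<lesssim> verts G"
    by (rule lepoll_trans[OF times_lepoll_mono[OF image_lepoll finite_lepoll_infinite[OF inf]] sq]) simp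
  have B: "(base :: ('a set \<times> nat) set) \<lesssim> verts G"
    using inf by (intro finite_lepoll_infinite) (auto simp: base_def)
  show "pts G \<lesssim> verts G"
    unfolding pts_def using B V E inf by (intro Un_lepoll_infinite)
qed

section \<open>Valencies\<close>

definition valency :: "'v graph \<Rightarrow> 'v set \<times> nat \<Rightarrow> nat" where
  "valency G p = card {l \<in> blocks G. p \<in> l}"

text \<open>Strips and rails are counted separately; stars contain no base point. Lists are used so
  that all 17 values can be computed by evaluation.\<close>

definition base_valency :: "nat \<Rightarrow> nat" where
  "base_valency i = length (filter (\<lambda>j. i = j \<or> i = j + 1 \<or> i = j + 3) [0..<14]) +
     length (filter (\<lambda>k. i = 4 \<or> i = 8 + k \<or> i = 14 + k) [0..<3])"

text \<open>Point 0 lies on \<open>strip 0\<close> alone, while 4 lies on the strips 1, 3, 4 and on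
  all three rails. Points 15 and 16 also lie on a single strip, but a rail through each of them
  raises the valency to 2.\<close>

lemma base_valency_values:
  assumes "i < 17"
  shows "base_valency i = 1 \<longleftrightarrow> i = 0" "base_valency i = 6 \<longleftrightarrow> i = 4"
proof -
  have "\<forall>i\<in>set [0..<17]. (base_valency i = 1 \<longleftrightarrow> i = 0) \<and> (base_valency i = 6 \<longleftrightarrow> i = 4)"
    by code_simp
  then show "base_valency i = 1 \<longleftrightarrow> i = 0" "base_valency i = 6 \<longleftrightarrow> i = 4"
    using assms by auto
qed

lemma base_valency_1_3: "base_valency 1 = 2" "base_valency 3 = 3"
  by code_simp+

lemma rail_ne_star: "rail G k \<noteq> star G v"
proof -
  have "({}, 4) \<in> rail G k" "({}, 4) \<notin> star G v" by (auto simp: in_rail in_star)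
  then show ?thesis by metis
qed

lemma valency_base:
  fixes G :: "'v graph"
  assumes "i < 17" "is_graph G"
  shows "valency G ({}, i) = base_valency i"
proof -
  let ?I = "set (filter (\<lambda>j. i = j \<or> i = j + 1 \<or> i = j + 3) [0..<14])"
  let ?K = "set (filter (\<lambda>k. i = 4 \<or> i = 8 + k \<or> i = 14 + k) [0..<3])"
  have "{l \<in> blocks G. ({}, i) \<in> l} = strip ` ?I \<union> rail G ` ?K"
    using edge_not(1)[OF assms(2)] by (auto simp: blocks_def in_strip in_rail in_star)
  moreover have "inj_on (strip :: nat \<Rightarrow> ('v set \<times> nat) set) ?I"
  proof (rule inj_onI)
    fix j k :: nat assume eq: "(strip j :: ('v set \<times> nat) set) = strip k"
    have "({}, n) \<in> (strip j :: ('v set \<times> nat) set) \<longleftrightarrow> ({}, n) \<in> (strip k :: ('v set \<times> nat) set)" for n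
      using eq by simp
    \<comment> \<open>The index of a strip is its least point: \<open>j\<close> on
      \<open>strip k\<close> gives \<open>k \<le> j\<close>, and symmetrically.\<close>
    from this[of j] this[of k] show "j = k" by (auto simp: in_strip)
  qed
  moreover have "inj_on (rail G) ?K"
  proof (rule inj_onI)
    fix j k assume jk: "rail G j = rail G k" "j \<in> ?K" "k \<in> ?K"
    have "({}, n) \<in> rail G j \<longleftrightarrow> ({}, n) \<in> rail G k" for n
      using jk(1) by simp
    from this[of "8 + j"] jk(2,3) show "j = k" by (auto simp: in_rail)
  qed
  moreover have "(strip :: nat \<Rightarrow> ('v set \<times> nat) set) ` ?I \<inter> rail G ` ?K = {}"
  proof -
    have "strip j \<noteq> rail G k" if "k < 3" for j k
    proof
      assume eq: "strip j = rail G k"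
      \<comment> \<open>These points are pairwise at least 4 apart, whereas a strip spans only
        3.\<close>
      have "({}, 4) \<in> rail G k" "({}, 8 + k) \<in> rail G k" "({}, 14 + k) \<in> rail G k"
        by (simp_all add: in_rail)
      then show False unfolding eq[symmetric] in_strip by auto
    qed
    then show ?thesis by auto
  qed
  ultimately have "valency G ({}, i) = card ?I + card ?K"
    unfolding valency_def by (simp add: card_Un_disjoint card_image)
  also have "card ?I = length (filter (\<lambda>j. i = j \<or> i = j + 1 \<or> i = j + 3) [0..<14])"
    by (rule distinct_card) simp
  also have "card ?K = length (filter (\<lambda>k. i = 4 \<or> i = 8 + k \<or> i = 14 + k) [0..<3])"
    by (rule distinct_card) simp
  finally show ?thesis unfolding base_valency_def .
qed

lemma block_through_0:
  assumes "is_graph G" "l \<in> blocks G" "({}, 0) \<in> l"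
  shows "l = strip 0"
  using assms(2,3) edge_not[OF assms(1)]
  by (cases rule: block_cases) (simp_all add: in_strip in_rail in_star)

lemma blocks_through_vertex:
  assumes "is_graph G" "v \<in> verts G" "k < 3"
  shows "{l \<in> blocks G. ({v}, k) \<in> l} = {star G v, rail G k}"
  using assms edge_not[OF assms(1)] by (auto simp: blocks_def in_strip in_rail in_star)

lemma blocks_through_edge:
  assumes "is_graph G" "{u, v} \<in> edges G" "u \<noteq> v"
  shows "{l \<in> blocks G. ({u, v}, 0) \<in> l} = {star G u, star G v}"
proof -
  have "u \<in> verts G" "v \<in> verts G" using assms(1,2) by (auto simp: is_graph_def)
  then show ?thesis
    using assms by (auto simp: blocks_def in_strip in_rail in_star doubleton_eq_iff)
qed

lemma star_eq_iff: 
  assumes "is_graph G"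
  shows "star G u = star G v \<longleftrightarrow> u = v"
proof
  assume eq: "star G u = star G v"
  have "({u}, 0) \<in> star G v" by (simp add: in_star flip: eq)
  then show "u = v" using edge_not[OF assms] by (simp add: in_star)
qed simp

text \<open>A vertex point lies on its star and one rail, an edge point on the stars of its two
  ends; in both cases the two blocks differ.\<close>

lemma blocks_through_nonbase:
  assumes G: "is_graph G" and p: "p \<in> pts G - base"
  shows "finite {l \<in> blocks G. p \<in> l} \<and> card {l \<in> blocks G. p \<in> l} = 2"
proof -
  obtain s n where [simp]: "p = (s, n)" by fastforce
  from p consider v where "v \<in> verts G" "s = {v}" "n < 3" | "n = 0" "s \<in> edges G"
    by (auto simp: in_pts in_base)
  then show ?thesis
  proof cases
    case 1
    then show ?thesis using blocks_through_vertex[OF G 1(1,3)] rail_ne_star[of G n v]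
      by simp
  next
    case 2
    from edge_cases[OF G 2(2)] obtain u v where uv: "s = {u, v}" "u \<noteq> v" by metis
    then show ?thesis
      using blocks_through_edge[OF G, of u v] 2 star_eq_iff[OF G] by simp
  qed
qed

text \<open>Off the base the valency is 2, which is neither 1 nor 6, so only the 17 computed values
  matter.\<close>

lemma valency_eq_iff:
  assumes "is_graph G" "p \<in> pts G"
  shows "valency G p = 1 \<longleftrightarrow> p = ({}, 0)" "valency G p = 6 \<longleftrightarrow> p = ({}, 4)"
proof -
  have "(valency G p = 1 \<longleftrightarrow> p = ({}, 0)) \<and> (valency G p = 6 \<longleftrightarrow> p = ({}, 4))"
  proof (cases "p \<in> base")
    case True
    then obtain i where "i < 17" "p = ({}, i)" by (auto simp: base_def)
    then show ?thesis using valency_base[OF _ assms(1), of i] base_valency_values[of i] by simp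
  next
    case False
    then have "valency G p = 2" using blocks_through_nonbase[OF assms(1)] assms(2) by (simp add: valency_def)
    moreover have "({}, 0) \<in> base" "({}, 4) \<in> base" by (simp_all add: in_base)
    ultimately show ?thesis using False by auto
  qed
  then show "valency G p = 1 \<longleftrightarrow> p = ({}, 0)" "valency G p = 6 \<longleftrightarrow> p = ({}, 4)" by auto
qed

section \<open>Isomorphisms\<close>

text \<open>Lines consist of points and incidence is preserved in both directions, so the map on
  points forces the map on lines.\<close>

lemma plane_iso_image:
  assumes iso: "plane_iso f g P Q" and "is_plane P" "is_plane Q" and l: "l \<in> lines P"
  shows "g l = f ` l"
proof -
  have f: "bij_betw f (points P) (points Q)" and g: "g l \<in> lines Q"
    and inc: "\<And>p. p \<in> points P \<Longrightarrow> p \<in> l \<longleftrightarrow> f p \<in> g l"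
    using iso l by (auto simp: plane_iso_def bij_betw_def)
  have sub: "l \<subseteq> points P" and "g l \<subseteq> points Q"
    using assms(2,3) l g by (auto simp: is_plane_def)
  then have "g l = {q \<in> f ` points P. q \<in> g l}" using bij_betw_imp_surj_on[OF f] by blast
  also have "\<dots> = f ` {p \<in> points P. p \<in> l}" using inc by auto
  also have "{p \<in> points P. p \<in> l} = l" using sub by blast
  finally show ?thesis .
qed

section \<open>Reconstruction of a graph isomorphism from a bijection preserving blocks\<close>

locale block_iso =
  fixes G :: "'a graph" and H :: "'b graph" and f :: "'a set \<times> nat \<Rightarrow> 'b set \<times> nat"
  assumes G: "is_graph G" and H: "is_graph H"
    and bij_pts: "bij_betw f (pts G) (pts H)"
    and bij_blocks: "bij_betw (image f) (blocks G) (blocks H)"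
begin

lemma inj_f: "p \<in> pts G \<Longrightarrow> q \<in> pts G \<Longrightarrow> f p = f q \<longleftrightarrow> p = q"
  using bij_pts by (auto simp: bij_betw_def inj_on_def)

lemma f_pts: "p \<in> pts G \<Longrightarrow> f p \<in> pts H"
  using bij_pts by (auto simp: bij_betw_def)

lemma f_blocks: "l \<in> blocks G \<Longrightarrow> f ` l \<in> blocks H"
  using bij_blocks by (auto simp: bij_betw_def)

lemma f_mem: "p \<in> pts G \<Longrightarrow> l \<in> blocks G \<Longrightarrow> f p \<in> f ` l \<longleftrightarrow> p \<in> l"
  using blocks_subset[of l G] inj_on_image_mem_iff[OF bij_betw_imp_inj_on[OF bij_pts]] by blast

lemma valency_f:
  assumes "p \<in> pts G"
  shows "valency H (f p) = valency G p"
proof -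
  have "{m \<in> blocks H. f p \<in> m} = image f ` {l \<in> blocks G. p \<in> l}"
    using bij_blocks f_mem[OF assms] unfolding bij_betw_def by blast
  moreover have "inj_on (image f) {l \<in> blocks G. p \<in> l}"
    using bij_blocks unfolding bij_betw_def by (rule conjE) (auto elim: inj_on_subset)
  ultimately show ?thesis by (simp add: valency_def card_image)
qed

lemma base_pts: "i < 17 \<Longrightarrow> ({}, i) \<in> pts K"
  by (simp add: in_pts)

lemma f_0: "f ({}, 0) = ({}, 0)"
  using valency_f[of "({}, 0)"] valency_eq_iff(1)[OF G, of "({}, 0)"] valency_eq_iff(1)[OF H, of "f ({}, 0)"]
    f_pts[of "({}, 0)"] by (simp add: base_pts)

lemma f_4: "f ({}, 4) = ({}, 4)"
  using valency_f[of "({}, 4)"] valency_eq_iff(2)[OF G, of "({}, 4)"] valency_eq_iff(2)[OF H, of "f ({}, 4)"]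
    f_pts[of "({}, 4)"] by (simp add: base_pts)

lemma strip_block: "i < 14 \<Longrightarrow> strip i \<in> blocks K"
  by (simp add: blocks_def)

lemma f_strip_0: "f ` strip 0 = strip 0"
proof -
  have "f ` strip 0 \<in> blocks H" by (simp add: f_blocks strip_block)
  moreover have "({}, 0) \<in> f ` strip 0"
    using f_0 by (intro image_eqI[of _ _ "({}, 0)"]) (simp_all add: in_strip)
  ultimately show ?thesis by (rule block_through_0[OF H])
qed

text \<open>The strip through the only point of valency 1 has points of valencies 1, 2 and 3.\<close>

lemma f_1: "f ({}, 1) = ({}, 1)"
proof -
  have "f ({}, 1) \<in> f ` strip 0" by (rule imageI) (simp add: in_strip)
  then have "f ({}, 1) \<in> {({}, 0), ({}, 1), ({}, 3)}" by (simp only: f_strip_0) (simp add: strip_def)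
  moreover have "f ({}, 1) \<noteq> ({}, 0)"
    using inj_f[of "({}, 1)" "({}, 0)"] f_0 by (simp add: base_pts)
  moreover have "f ({}, 1) \<noteq> ({}, 3)"
  proof
    assume "f ({}, 1) = ({}, 3)"
    then have "valency H ({}, 3) = valency G ({}, 1)" using valency_f[of "({}, 1)"] by (simp add: base_pts)
    then show False using valency_base[OF _ G, of 1] valency_base[OF _ H, of 3] base_valency_1_3 by simp
  qed
  ultimately show ?thesis by blast
qed

text \<open>Two fixed points lie on the strip and on its image, so these blocks coincide, and
  injectivity leaves only its own place for the third point. The set equation lets any two points of
  the strip be the fixed ones.\<close>

lemma third_point:
  assumes "i < 14" and abc: "{a, b, c} = {i, i + 1, i + 3}" "a \<noteq> b" "a \<noteq> c" "b \<noteq> c"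
    and fixed: "f ({}, a) = ({}, a)" "f ({}, b) = ({}, b)"
  shows "f ({}, c) = ({}, c)"
proof -
  have mem: "x = i \<or> x = i + 1 \<or> x = i + 3 \<longleftrightarrow> x = a \<or> x = b \<or> x = c" for x
    using abc(1) by blast
  have "a \<in> {i, i + 1, i + 3}" "b \<in> {i, i + 1, i + 3}" "c \<in> {i, i + 1, i + 3}"
    unfolding abc(1)[symmetric] by simp_all
  then have lt: "a < 17" "b < 17" "c < 17" using assms(1) by auto
  have image: "f ({}, x) \<in> f ` strip i" if "x = a \<or> x = b \<or> x = c" for x
    using that unfolding mem[symmetric] by (intro imageI) (simp only: in_strip)
  have "f ` strip i = strip i"
  proof (rule blocks_meet[OF H])
    show "({}, a) \<in> f ` strip i" "({}, b) \<in> f ` strip i"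
      using image[of a] image[of b] fixed by simp_all
    show "({}, a) \<in> strip i" "({}, b) \<in> strip i"
      unfolding in_strip mem by simp_all
  qed (simp_all add: f_blocks strip_block assms(1) abc(2))
  with image[of c] have "f ({}, c) \<in> strip i" by simp
  then obtain x where x: "f ({}, c) = ({}, x)" "x = a \<or> x = b \<or> x = c"
    by (cases "f ({}, c)") (simp only: in_strip mem simp_thms)
  then show ?thesis
    using inj_f[of "({}, c)" "({}, a)"] inj_f[of "({}, c)" "({}, b)"] fixed abc(2-4) lt by (auto simp: base_pts)
qed

text \<open>For \<open>i \<ge> 3\<close> the points \<open>i - 3\<close> and \<open>i - 2\<close>
  determine \<open>i\<close> on \<open>strip (i - 3)\<close>, which is available because
  \<open>i < 17\<close> means \<open>i - 3 < 14\<close>. Point 2 is not the last point of any strip;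
  it is obtained from 1 and 4 on \<open>strip 1\<close>, and this is where the recognition of 4 by
  its valency enters.\<close>

lemma f_base: "i < 17 \<Longrightarrow> f ({}, i) = ({}, i)"
proof (induction i rule: less_induct)
  case (less i)
  consider "i = 0" | "i = 1" | "i = 2" | "i \<ge> 3" by linarith
  then show ?case
  proof cases
    case 1
    then show ?thesis using f_0 by simp
  next
    case 2
    then show ?thesis using f_1 by simp
  next
    case 3
    have "{1, 4, 2} = {1, 1 + 1, 1 + 3 :: nat}" by auto
    then have "f ({}, 2) = ({}, 2)" using f_1 f_4 by (intro third_point[of 1 1 4 2]) simp_all
    then show ?thesis using 3 by simp
  next
    case 4
    then obtain j where j: "i = j + 3" by (metis add.commute le_Suc_ex)
    then have "f ({}, j) = ({}, j)" "f ({}, j + 1) = ({}, j + 1)"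
      using less.IH[of j] less.IH[of "j + 1"] less.prems by simp_all
    then show ?thesis
      using third_point[of j j "j + 1" "j + 3"] less.prems j by simp
  qed
qed

lemma rail_block: "k < 3 \<Longrightarrow> rail K k \<in> blocks K"
  by (simp add: blocks_def)

lemma star_block: "v \<in> verts K \<Longrightarrow> star K v \<in> blocks K"
  by (simp add: blocks_def)

text \<open>The rail contains the fixed points 4 and \<open>8 + k\<close>, and two points determine
  a block.\<close>

lemma f_rail:
  assumes "k < 3"
  shows "f ` rail G k = rail H k"
proof -
  have "({}, i) \<in> f ` rail G k" if "i < 17" "({}, i) \<in> rail G k" for i
    using f_base[OF that(1)] that(2) by (metis imageI)
  from this[of 4] this[of "8 + k"] have "({}, 4) \<in> f ` rail G k" "({}, 8 + k) \<in> f ` rail G k"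
    using assms by (simp_all add: in_rail)
  then show ?thesis
    using blocks_meet[OF H, of "f ` rail G k" "rail H k" "({}, 4)" "({}, 8 + k)"]
    by (simp add: in_rail f_blocks rail_block assms)
qed

lemma vertex_pts: "v \<in> verts K \<Longrightarrow> k < 3 \<Longrightarrow> ({v}, k) \<in> pts K"
  by (simp add: in_pts)

lemma f_vertex_ex:
  assumes "v \<in> verts G" "k < 3"
  shows "\<exists>w\<in>verts H. f ({v}, k) = ({w}, k)"
proof -
  have "f ({v}, k) \<in> f ` rail G k" using assms by (intro imageI) (simp add: in_rail)
  then have "f ({v}, k) \<in> rail H k" using f_rail assms by simp
  moreover have "f ({v}, k) \<noteq> ({}, i)" if "i < 17" for i
    using inj_f[of "({v}, k)" "({}, i)"] f_base[OF that] that vertex_pts[OF assms] by (auto simp: base_pts)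
  ultimately show ?thesis using assms(2) by (auto simp: rail_def)
qed

text \<open>The vertex map is read off on rail 0. That the other two rails induce the same map
  follows in \<open>f_vertex\<close> by way of the stars.\<close>

definition h :: "'a \<Rightarrow> 'b" where
  "h v = (SOME w. w \<in> verts H \<and> f ({v}, 0) = ({w}, 0))"

lemma h: 
  assumes "v \<in> verts G"
  shows "h v \<in> verts H" "f ({v}, 0) = ({h v}, 0)"
  using someI_ex[of "\<lambda>w. w \<in> verts H \<and> f ({v}, 0) = ({w}, 0)"] f_vertex_ex[OF assms, of 0]
  unfolding h_def by auto

text \<open>Only the star of \<open>h v\<close> and rail 0 pass through \<open>({h v}, 0)\<close>,
  and rail 0 is already the image of a rail.\<close>

lemma f_star:
  assumes v: "v \<in> verts G"
  shows "f ` star G v = star H (h v)"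
proof -
  have "f ({v}, 0) \<in> f ` star G v" by (intro imageI) (simp add: in_star)
  then have "f ` star G v \<in> {l \<in> blocks H. ({h v}, 0) \<in> l}"
    using h(2)[OF v] f_blocks[OF star_block[OF v]] by simp
  then have "f ` star G v = star H (h v) \<or> f ` star G v = rail H 0"
    using blocks_through_vertex[OF H h(1)[OF v], of 0] by simp
  moreover have "f ` star G v \<noteq> rail H 0"
  proof
    assume "f ` star G v = rail H 0"
    then have "f ` star G v = f ` rail G 0" using f_rail[of 0] by simp
    then have "star G v = rail G 0"
      by (rule inj_onD[OF bij_betw_imp_inj_on[OF bij_blocks] _ star_block[OF v] rail_block]) simp
    then show False using rail_ne_star by metis
  qed
  ultimately show ?thesis by blast
qed

lemma f_vertex:
  assumes v: "v \<in> verts G" and k: "k < 3"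
  shows "f ({v}, k) = ({h v}, k)"
proof -
  obtain w where w: "w \<in> verts H" "f ({v}, k) = ({w}, k)" using f_vertex_ex[OF assms] by blast
  have "f ({v}, k) \<in> f ` star G v" using k by (intro imageI) (simp add: in_star)
  then have "({w}, k) \<in> star H (h v)" using f_star[OF v] w by simp
  then show ?thesis using w edge_not(2)[OF H] by (simp add: in_star)
qed

lemma h_bij: "bij_betw h (verts G) (verts H)"
proof (rule bij_betw_imageI)
  show "inj_on h (verts G)"
  proof (rule inj_onI)
    fix u v assume uv: "u \<in> verts G" "v \<in> verts G" "h u = h v"
    then have "f ({u}, 0) = f ({v}, 0)" using h(2) by simp
    then show "u = v" using inj_f[of "({u}, 0)" "({v}, 0)"] uv by (simp add: vertex_pts)
  qed
  have "\<exists>v\<in>verts G. w = h v" if w: "w \<in> verts H" for w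
  proof -
    have "({w}, 0) \<in> f ` rail G 0" using f_rail[of 0] w by (simp add: in_rail)
    then obtain p where p: "p \<in> rail G 0" "f p = ({w}, 0)" by (metis imageE)
    moreover have "p \<noteq> ({}, i)" if "i < 17" for i using p(2) f_base[OF that] by auto
    ultimately obtain v where "v \<in> verts G" "p = ({v}, 0)" by (auto simp: rail_def)
    then show ?thesis using h(2) p(2) by auto
  qed
  then show "h ` verts G = verts H" using h(1) by blast
qed

text \<open>Makes adjacency visible in the plane, so that a map taking stars to stars has to
  preserve it.\<close>

lemma star_inter:
  assumes "is_graph K" "u \<noteq> v"
  shows "p \<in> star K u \<and> p \<in> star K v \<longleftrightarrow> {u, v} \<in> edges K \<and> p = ({u, v}, 0)"
proof -
  obtain s n where [simp]: "p = (s, n)" by fastforce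
  show ?thesis
    using edge_not[OF assms(1)] assms(2) edge_eq[OF assms(1), of s u v] by (auto simp: in_star)
qed

lemma h_ne: "u \<in> verts G \<Longrightarrow> v \<in> verts G \<Longrightarrow> h u = h v \<longleftrightarrow> u = v"
  using h_bij by (auto simp: bij_betw_def inj_on_def)

lemma f_edge:
  assumes uv: "{u, v} \<in> edges G" "u \<noteq> v"
  shows "{h u, h v} \<in> edges H \<and> f ({u, v}, 0) = ({h u, h v}, 0)"
proof -
  have V: "u \<in> verts G" "v \<in> verts G" using uv(1) G by (auto simp: is_graph_def)
  have "f ({u, v}, 0) \<in> f ` star G u" "f ({u, v}, 0) \<in> f ` star G v"
    using uv by (auto intro!: imageI simp: in_star)
  then show ?thesis
    using star_inter[OF H, of "h u" "h v" "f ({u, v}, 0)"] f_star V h_ne uv(2) by simp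
qed

lemma h_iso: "graph_iso h G H"
  unfolding graph_iso_def
proof (intro conjI ballI h_bij)
  fix u v assume V: "u \<in> verts G" "v \<in> verts G"
  show "{u, v} \<in> edges G \<longleftrightarrow> {h u, h v} \<in> edges H"
  proof (cases "u = v")
    case True
    \<comment> \<open>\<open>graph_iso\<close> also speaks of equal vertices; a singleton is an edge
      on neither side.\<close>
    then show ?thesis using edge_not[OF G] edge_not[OF H] by simp
  next
    case ne: False
    show ?thesis
    proof
      show "{u, v} \<in> edges G \<Longrightarrow> {h u, h v} \<in> edges H" using f_edge ne by blast
    next
      assume "{h u, h v} \<in> edges H"
      then have "({h u, h v}, 0) \<in> f ` star G u" "({h u, h v}, 0) \<in> f ` star G v"
        using f_star V by (simp_all add: in_star)
      \<comment> \<open>The edge point has a preimage on either star. Injectivity identifies the two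
        preimages, which gives a common point of the stars of \<open>u\<close> and
        \<open>v\<close>.\<close>
      then obtain p q where p: "p \<in> star G u" "q \<in> star G v" "f p = ({h u, h v}, 0)" "f q = ({h u, h v}, 0)"
        by (auto elim!: imageE)
      then have "p \<in> pts G" "q \<in> pts G"
        using blocks_subset[OF star_block[OF V(1)]] blocks_subset[OF star_block[OF V(2)]] by blast+
      then have "p = q" using inj_f[of p q] p by simp
      then show "{u, v} \<in> edges G" using star_inter[OF G ne, of p] p by blast
    qed
  qed
qed

text \<open>Leaves \<open>f\<close> no freedom beyond \<open>h\<close>; hence every automorphism of
  the plane comes from the graph.\<close>

lemma f_eq_lift:
  assumes "p \<in> pts G"
  shows "f p = (h ` fst p, snd p)"
proof -
  obtain s n where [simp]: "p = (s, n)" by fastforce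
  from assms consider "s = {}" "n < 17" | v where "v \<in> verts G" "s = {v}" "n < 3" | "n = 0" "s \<in> edges G"
    by (auto simp: in_pts)
  then show ?thesis
  proof cases
    case 1
    then show ?thesis using f_base by simp
  next
    case 2
    then show ?thesis using f_vertex by simp
  next
    case 3
    from edge_cases[OF G 3(2)] obtain u v where uv: "s = {u, v}" "u \<noteq> v" by metis
    then show ?thesis using f_edge 3 by simp
  qed
qed

end

text \<open>Because points are sets of vertices with a tag, a single formula treats base, vertex and
  edge points alike; in particular base points stay fixed.\<close>

definition lift :: "('a \<Rightarrow> 'b) \<Rightarrow> 'a set \<times> nat \<Rightarrow> 'b set \<times> nat" where
  "lift h p = (h ` fst p, snd p)"

text \<open>An injective map preserves the cardinality of a line, hence its triviality, and blocks
  are exactly the non-trivial lines.\<close>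

lemma block_iso_of_plane_iso:
  assumes iso: "plane_iso f g (graph_plane G) (graph_plane H)" and G: "is_graph G" and H: "is_graph H"
  shows "block_iso G H f"
proof
  show f: "bij_betw f (pts G) (pts H)" using iso by (simp add: plane_iso_def)
  have g: "g l = f ` l" if "l \<in> lines (graph_plane G)" for l
    using that by (rule plane_iso_image[OF iso is_plane_graph_plane[OF G] is_plane_graph_plane[OF H]])
  have sub: "l \<subseteq> pts G" if "l \<in> lines (graph_plane G)" for l
    using is_plane_graph_plane[OF G] that by (simp add: is_plane_def)
  have triv: "trivial_line (f ` l) \<longleftrightarrow> trivial_line l" if "l \<in> lines (graph_plane G)" for l
    using sub[OF that] f card_image[of f l] unfolding trivial_line_def bij_betw_def
    by (metis inj_on_subset)
  have "bij_betw g (lines (graph_plane G)) (lines (graph_plane H))"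
    using iso by (simp add: plane_iso_def)
  then have b: "bij_betw (image f) (lines (graph_plane G)) (lines (graph_plane H))"
    using bij_betw_cong[of "lines (graph_plane G)" g "image f"] g by simp
  show "bij_betw (image f) (blocks G) (blocks H)"
  proof (rule bij_betw_imageI)
    show "inj_on (image f) (blocks G)"
      by (rule inj_on_subset[OF bij_betw_imp_inj_on[OF b]]) (simp add: block_iff subset_iff)
    have "blocks H = {m \<in> image f ` lines (graph_plane G). \<not> trivial_line m}"
      using block_iff[of _ H] by (auto simp: bij_betw_imp_surj_on[OF b])
    also have "\<dots> = image f ` {l \<in> lines (graph_plane G). \<not> trivial_line l}"
      using triv by auto
    also have "{l \<in> lines (graph_plane G). \<not> trivial_line l} = blocks G"
      using block_iff[of _ G] by auto
    finally show "image f ` blocks G = blocks H" ..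
  qed
qed (fact G H)+

lemma graph_iso_of_plane_iso:
  assumes "plane_iso f g (graph_plane G) (graph_plane H)" "is_graph G" "is_graph H"
  obtains h where "graph_iso h G H" "\<And>p. p \<in> pts G \<Longrightarrow> f p = lift h p"
    "\<And>l. l \<in> lines (graph_plane G) \<Longrightarrow> g l = lift h ` l"
proof -
  interpret block_iso G H f by (rule block_iso_of_plane_iso[OF assms])
  have 1: "f p = lift h p" if "p \<in> pts G" for p
    using f_eq_lift[OF that] by (simp add: lift_def)
  have "g l = lift h ` l" if l: "l \<in> lines (graph_plane G)" for l
  proof -
    have "l \<subseteq> pts G" using is_plane_graph_plane[OF G] l by (simp add: is_plane_def)
    moreover have "g l = f ` l"
      using l by (rule plane_iso_image[OF assms(1) is_plane_graph_plane[OF G] is_plane_graph_plane[OF H]])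
    ultimately show ?thesis using 1 by (auto intro!: image_cong)
  qed
  then show ?thesis using that h_iso 1 by blast
qed


section \<open>Lifting graph isomorphisms to planes\<close>

lemma plane_iso_of_blocks:
  assumes F: "bij_betw F X Y" and im: "image F ` M = N" and sub: "\<And>l. l \<in> M \<Longrightarrow> l \<subseteq> X"
  shows "plane_iso F (image F) (plane_of_blocks X M) (plane_of_blocks Y N)"
proof -
  let ?P = "plane_of_blocks X M" and ?Q = "plane_of_blocks Y N"
  have inj: "inj_on F X" and FX: "F ` X = Y" using F by (auto simp: bij_betw_def)
  have mem: "F p \<in> F ` l \<longleftrightarrow> p \<in> l" if "p \<in> X" "l \<subseteq> X" for p l
    using inj_on_image_mem_iff[OF inj that] .
  have sub': "l \<subseteq> X" if "l \<in> lines ?P" for l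
    using that sub unfolding lines_plane_of_blocks by auto
  \<comment> \<open>Being joined by a block is invariant, so added pairs go to added pairs, and
    every added pair arises in this way.\<close>
  have joined: "(\<exists>m\<in>N. F p \<in> m \<and> F q \<in> m) \<longleftrightarrow> (\<exists>l\<in>M. p \<in> l \<and> q \<in> l)" if "p \<in> X" "q \<in> X" for p q
    unfolding im[symmetric] using mem sub that by auto
  have ne: "F p \<noteq> F q \<longleftrightarrow> p \<noteq> q" if "p \<in> X" "q \<in> X" for p q
    using inj that by (auto dest: inj_onD)
  have image: "image F l \<in> lines ?Q" if l: "l \<in> lines ?P" for l
  proof (cases "l \<in> M")
    case True
    then show ?thesis using im by (intro block_in_lines) auto
  next
    case False
    then obtain p q where pq: "l = {p, q}" "p \<in> X" "q \<in> X" "p \<noteq> q" "\<not> (\<exists>l\<in>M. p \<in> l \<and> q \<in> l)"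
      using l unfolding lines_plane_of_blocks by blast
    have "F p \<in> Y" "F q \<in> Y" using pq(2,3) FX by blast+
    then have "{F p, F q} \<in> lines ?Q"
      by (rule pair_in_lines) (simp_all add: joined[OF pq(2,3)] ne[OF pq(2,3)] pq(4,5))
    then show ?thesis by (simp add: pq(1))
  qed
  have surj: "m \<in> image F ` lines ?P" if m: "m \<in> lines ?Q" for m
  proof (cases "m \<in> N")
    case True
    then obtain l where "l \<in> M" "m = F ` l" using im by auto
    then show ?thesis by (intro image_eqI[of _ _ l] block_in_lines)
  next
    case False
    then obtain a b where ab: "m = {a, b}" "a \<in> Y" "b \<in> Y" "a \<noteq> b" "\<not> (\<exists>l\<in>N. a \<in> l \<and> b \<in> l)"
      using m unfolding lines_plane_of_blocks by blast
    then obtain p q where pq: "p \<in> X" "q \<in> X" "a = F p" "b = F q" using FX by blast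
    from pq(1,2) have "{p, q} \<in> lines ?P"
      using ab(4,5) unfolding pq(3,4) joined[OF pq(1,2)] ne[OF pq(1,2)] by (rule pair_in_lines)
    then show ?thesis using ab(1) pq(3,4) by (intro image_eqI[of _ _ "{p, q}"]) simp_all
  qed
  have "inj_on (image F) (lines ?P)"
    using sub' by (intro inj_on_subset[OF inj_on_image_Pow[OF inj]]) auto
  moreover have "image F ` lines ?P = lines ?Q" using image surj by blast
  ultimately show ?thesis
    using F mem sub' by (simp add: plane_iso_def bij_betw_def)
qed

lemma fst_pts_subset:
  assumes "is_graph G" "p \<in> pts G"
  shows "fst p \<subseteq> verts G"
  using assms unfolding pts_def is_graph_def base_def by auto

lemma graph_iso_edges:
  assumes h: "graph_iso h G H" and G: "is_graph G" and H: "is_graph H"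
  shows "image h ` edges G = edges H"
proof -
  have bij: "bij_betw h (verts G) (verts H)"
    and edge: "\<And>x y. x \<in> verts G \<Longrightarrow> y \<in> verts G \<Longrightarrow> {x, y} \<in> edges G \<longleftrightarrow> {h x, h y} \<in> edges H"
    using h by (auto simp: graph_iso_def)
  show ?thesis
  proof (intro equalityI subsetI)
    fix e' assume "e' \<in> image h ` edges G"
    then obtain e where e: "e \<in> edges G" "e' = h ` e" by blast
    from edge_cases[OF G e(1)] obtain u v where "e = {u, v}" "u \<in> verts G" "v \<in> verts G" by metis
    then show "e' \<in> edges H" using e edge by simp
  next
    fix e' assume e': "e' \<in> edges H"
    from edge_cases[OF H e'] obtain a b where ab: "e' = {a, b}" "a \<in> verts H" "b \<in> verts H" by metis
    then obtain u v where uv: "u \<in> verts G" "v \<in> verts G" "a = h u" "b = h v"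
      using bij_betw_imp_surj_on[OF bij] by blast
    then have "{u, v} \<in> edges G" using edge e' ab(1) by simp
    then show "e' \<in> image h ` edges G" using ab(1) uv by (intro image_eqI[of _ _ "{u, v}"]) auto
  qed
qed

lemma plane_iso_lift:
  assumes h: "graph_iso h G H" and G: "is_graph G" and H: "is_graph H"
  shows "plane_iso (lift h) (image (lift h)) (graph_plane G) (graph_plane H)"
  unfolding graph_plane_def
proof (rule plane_iso_of_blocks)
  have bij: "bij_betw h (verts G) (verts H)" using h by (simp add: graph_iso_def)
  have V: "h ` verts G = verts H" and inj: "inj_on h (verts G)" using bij by (auto simp: bij_betw_def)
  have E: "image h ` edges G = edges H" by (rule graph_iso_edges[OF assms])
  have lift_base: "lift h ` base = base" 
    unfolding base_def image_image lift_def by simp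
  have "inj_on (lift h) (pts G)"
  proof (rule inj_onI)
    fix p q assume pq: "p \<in> pts G" "q \<in> pts G" "lift h p = lift h q"
    \<comment> \<open>First components are sets of vertices, and \<open>h\<close> is injective on
      vertices.\<close>
    then have "fst p = fst q"
      using inj_on_image_eq_iff[OF inj fst_pts_subset[OF G pq(1)] fst_pts_subset[OF G pq(2)]]
      by (simp add: lift_def)
    then show "p = q" using pq(3) by (simp add: lift_def prod_eq_iff)
  qed
  moreover have "lift h ` pts G = pts H"
  proof -
    have "lift h ` ((\<lambda>v. {v}) ` verts G \<times> {..<3}) = (\<lambda>v. {v}) ` verts H \<times> {..<3}"
      unfolding V[symmetric] by (auto simp: lift_def image_iff)
    moreover have "lift h ` (\<lambda>e. (e, 0)) ` edges G = (\<lambda>e. (e, 0)) ` edges H"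
      unfolding E[symmetric] image_image lift_def by simp
    ultimately show ?thesis unfolding pts_def image_Un lift_base by simp
  qed
  ultimately show "bij_betw (lift h) (pts G) (pts H)" by (simp add: bij_betw_def)
  have strip: "lift h ` strip i = strip i" for i by (simp add: strip_def lift_def)
  have rail: "lift h ` rail G k = rail H k" for k
    unfolding rail_def V[symmetric] by (simp add: lift_def image_Un image_image)
  have star: "lift h ` star G v = star H (h v)" if v: "v \<in> verts G" for v
  proof -
    have "h v \<in> h ` e \<longleftrightarrow> v \<in> e" if "e \<in> edges G" for e
      using inj_on_image_mem_iff[OF inj v] G that by (simp add: is_graph_def)
    then have "{e \<in> edges H. h v \<in> e} = image h ` {e \<in> edges G. v \<in> e}"
      unfolding E[symmetric] by auto
    then show ?thesis unfolding star_def by (simp add: lift_def image_Un image_image)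
  qed
  have "image (lift h) ` star G ` verts G = star H ` verts H"
    unfolding V[symmetric] image_image using star by (intro image_cong) auto
  then show "image (lift h) ` blocks G = blocks H"
    unfolding blocks_def image_Un by (simp add: image_image strip rail)
qed (rule blocks_subset)

section \<open>Isomorphism classes and automorphism groups\<close>

lemma graphs_isomorphic_iff:
  assumes "is_graph G" "is_graph H"
  shows "graphs_isomorphic G H \<longleftrightarrow> planes_isomorphic (graph_plane G) (graph_plane H)"
proof
  show "graphs_isomorphic G H \<Longrightarrow> planes_isomorphic (graph_plane G) (graph_plane H)"
    unfolding graphs_isomorphic_def planes_isomorphic_def using plane_iso_lift[OF _ assms] by metis
  show "planes_isomorphic (graph_plane G) (graph_plane H) \<Longrightarrow> graphs_isomorphic G H"
    unfolding graphs_isomorphic_def planes_isomorphic_def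
    using graph_iso_of_plane_iso[OF _ assms] by metis
qed

lemma lift_cong:
  assumes "is_graph G" "p \<in> pts G" "\<And>v. v \<in> verts G \<Longrightarrow> f v = g v"
  shows "lift f p = lift g p"
  using fst_pts_subset[OF assms(1,2)] assms(3) by (auto simp: lift_def intro!: image_cong)

lemma lines_subset_pts:
  assumes "is_graph G" "l \<in> lines (graph_plane G)"
  shows "l \<subseteq> pts G"
  using is_plane_graph_plane[OF assms(1)] assms(2) by (simp add: is_plane_def)

lemma plane_iso_cong:
  assumes "\<And>p. p \<in> points P \<Longrightarrow> f p = f' p" "\<And>l. l \<in> lines P \<Longrightarrow> g l = g' l"
  shows "plane_iso f g P Q \<longleftrightarrow> plane_iso f' g' P Q"
  using assms bij_betw_cong[of "points P" f f' "points Q"] bij_betw_cong[of "lines P" g g' "lines Q"]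
  by (simp add: plane_iso_def)

text \<open>Members of \<open>Bij\<close> are extensional, which explains the restrictions in \<phi>
  and why maps need to be compared on points, lines and vertices only. The homomorphism law is
  functoriality of \<open>lift\<close>; surjectivity holds because every automorphism of the plane
  is a lift.\<close>

lemma Aut_graph_iso_Aut_plane:
  assumes G: "is_graph G"
  shows "Aut_graph G \<cong> Aut_plane (graph_plane G)"
proof -
  let ?V = "verts G" and ?L = "lines (graph_plane G)"
  define \<phi> where "\<phi> f = (restrict (lift f) (pts G), restrict (image (lift f)) ?L)" for f :: "'a \<Rightarrow> 'a"
  have carrier_graph: "f \<in> carrier (Aut_graph G) \<longleftrightarrow> f \<in> Bij ?V \<and> graph_iso f G G" for f
    by (simp add: Aut_graph_def)
  have carrier_plane: "(F, K) \<in> carrier (Aut_plane (graph_plane G)) \<longleftrightarrow>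
      F \<in> Bij (pts G) \<and> K \<in> Bij ?L \<and> plane_iso F K (graph_plane G) (graph_plane G)" for F K
    by (simp add: Aut_plane_def)
  have closed: "\<phi> f \<in> carrier (Aut_plane (graph_plane G))" if f: "f \<in> carrier (Aut_graph G)" for f
  proof -
    have "plane_iso (lift f) (image (lift f)) (graph_plane G) (graph_plane G)"
      using plane_iso_lift[OF _ G G] f by (simp add: carrier_graph)
    then have iso: "plane_iso (restrict (lift f) (pts G)) (restrict (image (lift f)) ?L) (graph_plane G) (graph_plane G)"
      by (subst plane_iso_cong[where f' = "lift f" and g' = "image (lift f)"]) auto
    then show ?thesis
      unfolding \<phi>_def carrier_plane by (simp add: Bij_def plane_iso_def)
  qed
  have hom: "\<phi> (f \<otimes>\<^bsub>Aut_graph G\<^esub> g) = \<phi> f \<otimes>\<^bsub>Aut_plane (graph_plane G)\<^esub> \<phi> g"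
    if f: "f \<in> carrier (Aut_graph G)" and g: "g \<in> carrier (Aut_graph G)" for f g
  proof -
    have bij: "f \<in> Bij ?V" "g \<in> Bij ?V" using f g by (auto simp: carrier_graph)
    have phi: "fst (\<phi> f) \<in> Bij (pts G)" "snd (\<phi> f) \<in> Bij ?L" "fst (\<phi> g) \<in> Bij (pts G)" "snd (\<phi> g) \<in> Bij ?L"
      using closed[OF f] closed[OF g] carrier_plane by (metis prod.collapse)+
    have pt: "lift (compose ?V f g) p = lift f (lift g p)" if "p \<in> pts G" for p
      using fst_pts_subset[OF G that] by (force simp: lift_def compose_def image_image)
    have ln: "lift (compose ?V f g) ` l = lift f ` lift g ` l" if "l \<in> ?L" for l
      unfolding image_image using pt lines_subset_pts[OF G that] by (intro image_cong) auto
    have g_pts: "lift g p \<in> pts G" if "p \<in> pts G" for p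
      using phi(3) that by (auto simp: \<phi>_def Bij_def bij_betw_def)
    have g_lines: "lift g ` l \<in> ?L" if "l \<in> ?L" for l
      using phi(4) that by (auto simp: \<phi>_def Bij_def bij_betw_def)
    have "f \<otimes>\<^bsub>Aut_graph G\<^esub> g = compose ?V f g"
      using bij by (simp add: Aut_graph_def BijGroup_def)
    moreover have "\<phi> f \<otimes>\<^bsub>Aut_plane (graph_plane G)\<^esub> \<phi> g =
        (compose (pts G) (fst (\<phi> f)) (fst (\<phi> g)), compose ?L (snd (\<phi> f)) (snd (\<phi> g)))"
      using phi by (simp add: Aut_plane_def BijGroup_def DirProd_def case_prod_beta)
    moreover have "restrict (lift (compose ?V f g)) (pts G) = compose (pts G) (fst (\<phi> f)) (fst (\<phi> g))"
      using pt g_pts by (auto simp: fun_eq_iff compose_def \<phi>_def)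
    moreover have "restrict (image (lift (compose ?V f g))) ?L = compose ?L (snd (\<phi> f)) (snd (\<phi> g))"
      using ln g_lines by (auto simp: fun_eq_iff compose_def \<phi>_def)
    ultimately show ?thesis by (simp add: \<phi>_def)
  qed
  have inj: "inj_on \<phi> (carrier (Aut_graph G))"
  proof (rule inj_onI)
    fix f g assume fg: "f \<in> carrier (Aut_graph G)" "g \<in> carrier (Aut_graph G)" "\<phi> f = \<phi> g"
    have "f v = g v" if v: "v \<in> ?V" for v
    proof -
      \<comment> \<open>The value \<open>f v\<close> can be recovered from the lifted action on rail
        0.\<close>
      have "({v}, 0) \<in> pts G" using v by (simp add: in_pts)
      moreover have "fst (\<phi> f) ({v}, 0) = fst (\<phi> g) ({v}, 0)" using fg(3) by simp
      ultimately show ?thesis by (simp add: \<phi>_def lift_def)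
    qed
    moreover have "f \<in> extensional ?V" "g \<in> extensional ?V"
      using fg(1,2) by (auto simp: carrier_graph Bij_def)
    ultimately show "f = g" by (intro extensionalityI)
  qed
  have surj: "\<exists>f\<in>carrier (Aut_graph G). \<phi> f = (F, K)" if FK: "(F, K) \<in> carrier (Aut_plane (graph_plane G))" for F K
  proof -
    have bij: "F \<in> Bij (pts G)" "K \<in> Bij ?L" and iso: "plane_iso F K (graph_plane G) (graph_plane G)"
      using FK by (auto simp: carrier_plane)
    obtain h where h: "graph_iso h G G" and F: "\<And>p. p \<in> pts G \<Longrightarrow> F p = lift h p"
      and K: "\<And>l. l \<in> ?L \<Longrightarrow> K l = lift h ` l"
      using graph_iso_of_plane_iso[OF iso G G] by metis
    \<comment> \<open>Outside the vertices \<open>h\<close> is arbitrary, while members of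
      \<open>Bij\<close> must be \<open>undefined\<close> there.\<close>
    let ?h = "restrict h ?V"
    have iso': "graph_iso ?h G G"
      using h by (simp add: graph_iso_def)
    then have "?h \<in> carrier (Aut_graph G)"
      by (simp add: carrier_graph Bij_def graph_iso_def)
    moreover have pt: "lift ?h p = F p" if "p \<in> pts G" for p
      using lift_cong[OF G that, of ?h h] F[OF that] by simp
    have "restrict (lift ?h) (pts G) = F"
      using pt bij(1) by (intro extensionalityI[of _ "pts G"]) (auto simp: Bij_def)
    moreover have "lift ?h ` l = K l" if "l \<in> ?L" for l
      using K[OF that] pt F lines_subset_pts[OF G that] by (auto intro!: image_cong)
    then have "restrict (image (lift ?h)) ?L = K"
      using bij(2) by (intro extensionalityI[of _ ?L]) (auto simp: Bij_def)
    ultimately show ?thesis by (auto simp: \<phi>_def)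
  qed
  have "\<phi> \<in> iso (Aut_graph G) (Aut_plane (graph_plane G))"
    unfolding iso_def hom_def bij_betw_def
  proof (intro CollectI conjI ballI funcsetI)
    show "\<phi> ` carrier (Aut_graph G) = carrier (Aut_plane (graph_plane G))"
    proof (intro equalityI subsetI)
      fix y assume "y \<in> carrier (Aut_plane (graph_plane G))"
      then show "y \<in> \<phi> ` carrier (Aut_graph G)" using surj[of "fst y" "snd y"] by force
    qed (use closed in blast)
  qed (use closed hom inj in simp_all)
  then show ?thesis by (auto simp: is_iso_def)
qed

text \<open>The exceptional points are the base. Finiteness accompanies the bound because
  \<open>card\<close> of an infinite set is 0.\<close>

lemma few_nontrivial_lines:
  assumes G: "is_graph G"
  shows "\<exists>X. X \<subseteq> points (graph_plane G) \<and> card X = 17 \<and>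
    (\<forall>p\<in>points (graph_plane G) - X. finite (nontrivial_lines_through (graph_plane G) p) \<and>
       card (nontrivial_lines_through (graph_plane G) p) \<le> 2)"
proof (intro exI[of _ base] conjI ballI)
  show "base \<subseteq> points (graph_plane G)" unfolding points_graph_plane pts_def by blast
  show "card base = 17" unfolding base_def by (simp add: card_image inj_on_def)
qed (use blocks_through_nonbase[OF G] in \<open>simp_all add: nontrivial_graph_plane\<close>)

section \<open>Borel measurability\<close>

text \<open>Second countability allows Borel measurability into the product spaces to be checked
  coordinatewise.\<close>

instance bool :: second_countable_topology
proof
  show "\<exists>B::bool set set. countable B \<and> open = generate_topology B"
    by (intro exI[of _ "range lessThan \<union> range greaterThan"]) (auto simp: open_bool_def)
qed

lemma borel_measurable_bool: "(f :: 'a \<Rightarrow> bool) \<in> borel_measurable M \<longleftrightarrow> Measurable.pred M f"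
proof -
  have "borel_measurable M = measurable M (count_space (UNIV :: bool set))"
    by (rule measurable_cong_sets) (simp_all add: sets_borel_eq_count_space)
  then show ?thesis by simp
qed

text \<open>Each step takes the least element beyond the previous one, and a least number satisfying
  measurable conditions is measurable. Infinity of the sets yields the recursion equation of
  \<open>enumerate\<close>.\<close>

lemma measurable_enumerate:
  assumes C: "\<And>m. Measurable.pred M (\<lambda>x. m \<in> C x)" and inf: "\<And>x. x \<in> space M \<Longrightarrow> infinite (C x :: nat set)"
  shows "(\<lambda>x. enumerate (C x) n) \<in> measurable M (count_space UNIV)"
proof (induction n)
  case 0
  show ?case unfolding enumerate_0 by (rule measurable_Least) (rule C)
next
  case (Suc n)
  note [measurable] = C Suc.IH
  have "(\<lambda>x. LEAST s. s \<in> C x \<and> enumerate (C x) n < s) \<in> measurable M (count_space UNIV)"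
    by measurable
  then show ?case
    by (subst measurable_cong[OF enumerate_Suc''[OF inf]])
qed

text \<open>
  A plane whose points are numbered is coded as follows: \<open>T a\<close> says that \<open>a\<close> numbers a point,
  and \<open>J a b c\<close> that \<open>c\<close> lies on the line through the distinct points \<open>a\<close> and \<open>b\<close>. Points receive
  even codes. Lines receive odd codes, determined by the least of the pairs of distinct points on
  the line. As the codes in use depend on the plane, they are finally replaced by their ranks.
\<close>

definition leading :: "(nat \<Rightarrow> nat \<Rightarrow> nat \<Rightarrow> bool) \<Rightarrow> nat \<Rightarrow> bool" where
  "leading J t \<longleftrightarrow> J (fst (prod_decode t)) (snd (prod_decode t)) (fst (prod_decode t)) \<and>
    (\<forall>u<t. fst (prod_decode u) \<noteq> snd (prod_decode u) \<longrightarrow>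
      \<not> (J (fst (prod_decode t)) (snd (prod_decode t)) (fst (prod_decode u)) \<and>
          J (fst (prod_decode t)) (snd (prod_decode t)) (snd (prod_decode u))))"

definition codes :: "(nat \<Rightarrow> bool) \<Rightarrow> (nat \<Rightarrow> nat \<Rightarrow> nat \<Rightarrow> bool) \<Rightarrow> nat set" where
  "codes T J = {m. even m \<and> T (m div 2) \<or> odd m \<and> leading J (m div 2)}"

definition coded_plane :: "(nat \<Rightarrow> bool) \<Rightarrow> (nat \<Rightarrow> nat \<Rightarrow> nat \<Rightarrow> bool) \<Rightarrow> omega_plane" where
  "coded_plane T J =
    (\<lambda>n. even (enumerate (codes T J) n),
     \<lambda>n. odd (enumerate (codes T J) n),
     \<lambda>(m, n). even (enumerate (codes T J) m) \<and> odd (enumerate (codes T J) n) \<and>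
       J (fst (prod_decode (enumerate (codes T J) n div 2)))
         (snd (prod_decode (enumerate (codes T J) n div 2)))
         (enumerate (codes T J) m div 2))"

lemma measurable_coded_plane:
  assumes T [measurable]: "\<And>a. Measurable.pred M (\<lambda>x. T x a)"
    and J [measurable]: "\<And>a b c. Measurable.pred M (\<lambda>x. J x a b c)"
    and inf: "\<And>x. x \<in> space M \<Longrightarrow> infinite (codes (T x) (J x))"
  shows "(\<lambda>x. coded_plane (T x) (J x)) \<in> borel_measurable M"
proof -
  have "Measurable.pred M (\<lambda>x. m \<in> codes (T x) (J x))" for m
    unfolding codes_def leading_def mem_Collect_eq by measurable
  then have e [measurable]:
    "(\<lambda>x. enumerate (codes (T x) (J x)) n) \<in> measurable M (count_space UNIV)" for n
    using inf by (rule measurable_enumerate)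
  have E: "Measurable.pred M (\<lambda>x. even (enumerate (codes (T x) (J x)) n))"
    and O: "Measurable.pred M (\<lambda>x. odd (enumerate (codes (T x) (J x)) n))" for n
    by measurable
  \<comment> \<open>\<open>J\<close> is known to be measurable for constant arguments only, but the
    codes vary with \<open>x\<close>. Splitting over the countably many values of both codes makes
    the arguments constant.\<close>
  have "Measurable.pred M (\<lambda>x. \<exists>a b. enumerate (codes (T x) (J x)) m = a \<and> enumerate (codes (T x) (J x)) n = b \<and>
      even a \<and> odd b \<and> J x (fst (prod_decode (b div 2))) (snd (prod_decode (b div 2))) (a div 2))" for m n
    by measurable
  then have I: "Measurable.pred M (\<lambda>x. (\<lambda>(m, n). even (enumerate (codes (T x) (J x)) m) \<and> odd (enumerate (codes (T x) (J x)) n) \<and>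
       J x (fst (prod_decode (enumerate (codes (T x) (J x)) n div 2)))
         (snd (prod_decode (enumerate (codes (T x) (J x)) n div 2)))
         (enumerate (codes (T x) (J x)) m div 2)) i)" for i
    by (cases i) simp
  show ?thesis
    unfolding coded_plane_def
    by (intro borel_measurable_Pair measurable_coordinatewise_then_product; unfold borel_measurable_bool)
       (rule E O I)+
qed

text \<open>\<open>realises\<close> requires every natural number to stand for a point or a line.
  The codes in use have gaps, but as there are infinitely many of them, their ranks exhaust the
  natural numbers.\<close>

lemma realises_coded_plane:
  fixes P :: "'p plane" and d :: "nat \<Rightarrow> 'p"
  assumes plane: "is_plane P" and d: "inj d" "points P \<subseteq> range d" and inf: "infinite (points P)"
    and T: "\<And>a. T a \<longleftrightarrow> d a \<in> points P"
    and J: "\<And>a b c. J a b c \<longleftrightarrow> a \<noteq> b \<and> (\<exists>l\<in>lines P. d a \<in> l \<and> d b \<in> l \<and> d c \<in> l)"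
  shows "infinite (codes T J)" "realises (coded_plane T J) P"
proof -
  let ?C = "codes T J"
  have sub: "l \<subseteq> points P" if "l \<in> lines P" for l
    using plane that by (simp add: is_plane_def)
  have unique: "l = m" if "l \<in> lines P" "m \<in> lines P" "p \<in> l" "q \<in> l" "p \<in> m" "q \<in> m" "p \<noteq> q" for l m p q
  proof -
    have "\<forall>l\<in>lines P. \<forall>m\<in>lines P. l \<noteq> m \<longrightarrow> (\<forall>p\<in>l \<inter> m. \<forall>q\<in>l \<inter> m. p = q)"
      using plane by (simp add: is_plane_def)
    then show ?thesis using that by blast
  qed
  have two: "\<exists>p\<in>l. \<exists>q\<in>l. p \<noteq> q" if "l \<in> lines P" for l
    using plane that by (simp add: is_plane_def)
  have d_eq: "d a = d b \<longleftrightarrow> a = b" for a b using d(1) by (simp add: inj_eq)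
  define c where "c p = inv_into UNIV d p" for p
  have dc: "d (c p) = p" if "p \<in> points P" for p
    using d(2) that unfolding c_def by (intro f_inv_into_f) auto
  have cd: "c (d a) = a" for a unfolding c_def using d(1) by simp
  define on where "on t l \<longleftrightarrow> fst (prod_decode t) \<noteq> snd (prod_decode t) \<and>
    d (fst (prod_decode t)) \<in> l \<and> d (snd (prod_decode t)) \<in> l" for t l
  define lc where "lc l = (LEAST t. on t l)" for l
  have on_ex: "\<exists>t. on t l" if l: "l \<in> lines P" for l
  proof -
    obtain p q where pq: "p \<in> l" "q \<in> l" "p \<noteq> q" using two[OF l] by blast
    then have "p \<in> points P" "q \<in> points P" using sub[OF l] by auto
    then have "d (c p) = p" "d (c q) = q" using dc by simp_all
    then have "c p \<noteq> c q" using pq(3) by metis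
    then have "on (prod_encode (c p, c q)) l"
      using pq(1,2) \<open>d (c p) = p\<close> \<open>d (c q) = q\<close> by (simp add: on_def)
    then show ?thesis ..
  qed
  have on_lc: "on (lc l) l" if "l \<in> lines P" for l
    unfolding lc_def using on_ex[OF that] by (rule LeastI_ex)
  have on_unique: "l = m" if "on t l" "on t m" "l \<in> lines P" "m \<in> lines P" for t l m
    using unique[OF that(3,4), of "d (fst (prod_decode t))" "d (snd (prod_decode t))"] that(1,2) d_eq
    by (simp add: on_def)
  \<comment> \<open>The pair coded by \<open>t\<close> lies on no line but \<open>l\<close>, so
    joining it gives back \<open>l\<close>.\<close>
  have J_on: "J (fst (prod_decode t)) (snd (prod_decode t)) a \<longleftrightarrow> d a \<in> l" if "on t l" "l \<in> lines P" for t l a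
  proof
    assume "J (fst (prod_decode t)) (snd (prod_decode t)) a"
    then obtain m where "m \<in> lines P" "on t m" "d a \<in> m" by (auto simp: J on_def)
    then show "d a \<in> l" using on_unique that by metis
  next
    assume "d a \<in> l"
    then show "J (fst (prod_decode t)) (snd (prod_decode t)) a" using that by (auto simp: J on_def)
  qed
  have leading_iff: "leading J t \<longleftrightarrow> (\<exists>l\<in>lines P. t = lc l)" for t
  proof
    assume t: "leading J t"
    \<comment> \<open>The conjunct \<open>J a b a\<close> of \<open>leading\<close> says that
      \<open>a\<close> and \<open>b\<close> are distinct and joined by a line, that is, that
      \<open>t\<close> codes a pair on some line.\<close>
    then obtain l where l: "l \<in> lines P" "on t l" by (auto simp: leading_def J on_def)
    have "\<not> on u l" if "u < t" for u
      using t that J_on[OF l(2,1)] by (auto simp: leading_def on_def)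
    then have "lc l = t" unfolding lc_def using l(2) by (intro Least_equality) (auto simp: not_less[symmetric])
    then show "\<exists>l\<in>lines P. t = lc l" using l by blast
  next
    assume "\<exists>l\<in>lines P. t = lc l"
    then obtain l where l: "l \<in> lines P" "t = lc l" by blast
    have on: "on t l" using on_lc l by simp
    moreover have "\<not> on u l" if "u < t" for u using not_less_Least[of u "\<lambda>t. on t l"] that l(2) by (simp add: lc_def)
    ultimately show "leading J t"
      using J_on[OF on l(1)] by (auto simp: leading_def on_def)
  qed
  have lc_inj: "inj_on lc (lines P)"
    using on_lc on_unique by (metis inj_onI)
  have pc: "bij_betw (\<lambda>p. 2 * c p) (points P) {m \<in> ?C. even m}"
  proof (rule bij_betw_imageI)
    show "inj_on (\<lambda>p. 2 * c p) (points P)" using dc by (intro inj_onI) (metis mult_cancel1 zero_neq_numeral)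
    have "m \<in> (\<lambda>p. 2 * c p) ` points P \<longleftrightarrow> m \<in> ?C \<and> even m" for m
    proof
      assume "m \<in> (\<lambda>p. 2 * c p) ` points P"
      then show "m \<in> ?C \<and> even m" using dc by (auto simp: codes_def T)
    next
      assume m: "m \<in> ?C \<and> even m"
      then have "d (m div 2) \<in> points P" by (auto simp: codes_def T)
      then show "m \<in> (\<lambda>p. 2 * c p) ` points P" using m by (intro image_eqI[of _ _ "d (m div 2)"]) (simp_all add: cd)
    qed
    then show "(\<lambda>p. 2 * c p) ` points P = {m \<in> ?C. even m}" by blast
  qed
  have lcc: "bij_betw (\<lambda>l. 2 * lc l + 1) (lines P) {m \<in> ?C. odd m}"
  proof (rule bij_betw_imageI)
    show "inj_on (\<lambda>l. 2 * lc l + 1) (lines P)" using lc_inj by (auto simp: inj_on_def)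
    have "m \<in> (\<lambda>l. 2 * lc l + 1) ` lines P \<longleftrightarrow> m \<in> ?C \<and> odd m" for m
    proof
      assume "m \<in> (\<lambda>l. 2 * lc l + 1) ` lines P"
      then show "m \<in> ?C \<and> odd m" by (auto simp: codes_def leading_iff)
    next
      assume m: "m \<in> ?C \<and> odd m"
      then obtain l where "l \<in> lines P" "m div 2 = lc l" by (auto simp: codes_def leading_iff)
      moreover from this have "m = 2 * lc l + 1" using m odd_two_times_div_two_succ[of m] by simp
      ultimately show "m \<in> (\<lambda>l. 2 * lc l + 1) ` lines P" by (intro image_eqI[of _ _ l])
    qed
    then show "(\<lambda>l. 2 * lc l + 1) ` lines P = {m \<in> ?C. odd m}" by blast
  qed
  have "infinite {m \<in> ?C. even m}" using bij_betw_finite[OF pc] inf by simp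
  then show infC: "infinite ?C" using finite_subset[of "{m \<in> ?C. even m}" ?C] by auto
  define e where "e = enumerate ?C"
  define r where "r = inv_into UNIV e"
  have e: "bij_betw e UNIV ?C" unfolding e_def by (rule bij_enumerate[OF infC])
  have er: "e (r m) = m" if "m \<in> ?C" for m
    using that bij_betw_imp_surj_on[OF e] unfolding r_def by (intro f_inv_into_f) simp
  \<comment> \<open>The property \<open>Q\<close> is left open so as to serve both parities.\<close>
  have r_bij: "bij_betw r {m \<in> ?C. Q m} {n. Q (e n)}" for Q
  proof (rule bij_betw_imageI)
    show "inj_on r {m \<in> ?C. Q m}" using er by (intro inj_onI) (metis (no_types, lifting) mem_Collect_eq)
    have "n \<in> r ` {m \<in> ?C. Q m} \<longleftrightarrow> Q (e n)" for n
    proof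
      assume "Q (e n)"
      moreover have "e n \<in> ?C" using e by (auto simp: bij_betw_def)
      moreover have "r (e n) = n" using e unfolding r_def by (simp add: bij_betw_def)
      ultimately show "n \<in> r ` {m \<in> ?C. Q m}" by (intro image_eqI[of _ _ "e n"]) simp_all
    qed (use er in auto)
    then show "r ` {m \<in> ?C. Q m} = {n. Q (e n)}" by blast
  qed
  have F: "bij_betw (r \<circ> (\<lambda>p. 2 * c p)) (points P) {n. even (e n)}"
    using pc r_bij by (rule bij_betw_trans)
  have K: "bij_betw (r \<circ> (\<lambda>l. 2 * lc l + 1)) (lines P) {n. odd (e n)}"
    using lcc r_bij by (rule bij_betw_trans)
  have inc: "p \<in> l \<longleftrightarrow> J (fst (prod_decode (e (r (2 * lc l + 1)) div 2)))
       (snd (prod_decode (e (r (2 * lc l + 1)) div 2))) (e (r (2 * c p)) div 2)"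
    and ev: "even (e (r (2 * c p)))" and od: "odd (e (r (2 * lc l + 1)))"
    if pl: "p \<in> points P" "l \<in> lines P" for p l
  proof -
    have "2 * c p \<in> ?C" "2 * lc l + 1 \<in> ?C" 
      using pc lcc pl by (auto simp: bij_betw_def)
    then have "e (r (2 * c p)) = 2 * c p" "e (r (2 * lc l + 1)) = 2 * lc l + 1" using er by auto
    then show "p \<in> l \<longleftrightarrow> J (fst (prod_decode (e (r (2 * lc l + 1)) div 2)))
       (snd (prod_decode (e (r (2 * lc l + 1)) div 2))) (e (r (2 * c p)) div 2)"
      "even (e (r (2 * c p)))" "odd (e (r (2 * lc l + 1)))"
      using J_on[OF on_lc[OF pl(2)] pl(2)] dc[OF pl(1)] by simp_all
  qed
  show "realises (coded_plane T J) P"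
    unfolding coded_plane_def realises.simps e_def[symmetric]
  proof (intro conjI exI)
    show "bij_betw (r \<circ> (\<lambda>p. 2 * c p)) (points P) {n. even (e n)}" by (rule F)
    show "bij_betw (r \<circ> (\<lambda>l. 2 * lc l + 1)) (lines P) {n. odd (e n)}" by (rule K)
  qed (use inc ev od in auto)
qed

text \<open>Allows the Borel map built for graphs on the natural numbers themselves to serve every
  injection \<open>e\<close>.\<close>

lemma realises_iso:
  assumes iso: "plane_iso f g P Q" and Q: "realises S Q"
  shows "realises S P"
proof -
  obtain Pt Li In where S: "S = (Pt, Li, In)" by (cases S) auto
  note Q' = Q[unfolded S realises.simps]
  from Q'[THEN conjunct2, THEN conjunct2] obtain f' g' where fg: "bij_betw f' (points Q) {n. Pt n}" "bij_betw g' (lines Q) {n. Li n}"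
    "\<forall>p\<in>points Q. \<forall>l\<in>lines Q. p \<in> l \<longleftrightarrow> In (f' p, g' l)"
    by blast
  have f: "bij_betw f (points P) (points Q)" and g: "bij_betw g (lines P) (lines Q)"
    and inc: "\<And>p l. p \<in> points P \<Longrightarrow> l \<in> lines P \<Longrightarrow> p \<in> l \<longleftrightarrow> f p \<in> g l"
    using iso by (auto simp: plane_iso_def)
  have "f p \<in> points Q" "g l \<in> lines Q" if "p \<in> points P" "l \<in> lines P" for p l
    using f g that by (auto simp: bij_betw_def)
  then have "\<forall>p\<in>points P. \<forall>l\<in>lines P. p \<in> l \<longleftrightarrow> In ((f' \<circ> f) p, (g' \<circ> g) l)"
    using inc fg(3) by simp
  then show ?thesis
    unfolding S realises.simps using Q'[THEN conjunct1] Q'[THEN conjunct2, THEN conjunct1] bij_betw_trans[OF f fg(1)] bij_betw_trans[OF g fg(2)]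
    by (intro conjI exI[of _ "f' \<circ> f"] exI[of _ "g' \<circ> g"])
qed

section \<open>Graphs on the natural numbers and the Borel realisation\<close>

lemma is_graph_of_omega:
  assumes R: "R \<in> omega_graphs" and e: "inj e"
  shows "is_graph (graph_of_omega e R)"
  unfolding is_graph_def
proof
  fix s assume "s \<in> edges (graph_of_omega e R)"
  then obtain m n where "s = {e m, e n}" "R (m, n)" by (auto simp: graph_of_omega_def)
  moreover from this have "e m \<noteq> e n" using R e by (auto simp: omega_graphs_def inj_eq)
  ultimately show "s \<subseteq> verts (graph_of_omega e R) \<and> card s = 2"
    by (simp add: graph_of_omega_def)
qed

lemma graph_iso_of_omega:
  assumes e: "inj e"
  shows "graph_iso (inv_into UNIV e) (graph_of_omega e R) (graph_of_omega id R)"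
  unfolding graph_iso_def
proof (intro conjI ballI)
  show "bij_betw (inv_into UNIV e) (verts (graph_of_omega e R)) (verts (graph_of_omega id R))"
    using bij_betw_inv_into[OF inj_on_imp_bij_betw[OF e]] by (simp add: graph_of_omega_def)
  fix x y assume "x \<in> verts (graph_of_omega e R)" "y \<in> verts (graph_of_omega e R)"
  then obtain a b where ab: "x = e a" "y = e b" by (auto simp: graph_of_omega_def)
  have "{e a, e b} = {e m, e n} \<longleftrightarrow> {a, b} = {m, n}" for m n
    using e by (simp add: doubleton_eq_iff inj_eq)
  then show "{x, y} \<in> edges (graph_of_omega e R) \<longleftrightarrow>
      {inv_into UNIV e x, inv_into UNIV e y} \<in> edges (graph_of_omega id R)"
    unfolding ab inv_f_f[OF e] by (simp add: graph_of_omega_def)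
qed

text \<open>A numbering independent of the graph: \<open>set_decode\<close> runs through the finite
  sets of natural numbers, and first components of points are finite. Whether a fixed number denotes
  a point is then a condition on the graph.\<close>

definition decode :: "nat \<Rightarrow> nat set \<times> nat" where
  "decode n = (set_decode (fst (prod_decode n)), snd (prod_decode n))"

lemma inj_decode: "inj decode"
proof (rule injI)
  fix m n assume "decode m = decode n"
  then have "prod_decode m = prod_decode n"
    by (metis decode_def prod.inject prod_eq_iff set_decode_inverse)
  then show "m = n" by (simp add: prod_decode_eq)
qed

lemma finite_fst_pts:
  assumes "is_graph G" "p \<in> pts G"
  shows "finite (fst p)"
proof -
  have "finite e" if "e \<in> edges G" for e
    using edge_cases[OF assms(1) that] by (metis finite.emptyI finite_insert)
  then show ?thesis using assms(2) unfolding pts_def base_def by auto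
qed

lemma pts_decode:
  assumes "is_graph G"
  shows "pts G \<subseteq> range decode"
proof
  fix p assume "p \<in> pts G"
  then have "finite (fst p)" using finite_fst_pts assms by blast
  then have "decode (prod_encode (set_encode (fst p), snd p)) = p"
    by (simp add: decode_def)
  then show "p \<in> range decode" by (metis rangeI)
qed

text \<open>For the graph on the natural numbers, being a point and being collinear are expressed by
  countable quantifiers over the coordinates \<open>R (m, n)\<close>, so the coded plane is a Borel
  function of \<open>R\<close>.\<close>

lemma borel_realisation:
  "\<exists>B :: omega_graph \<Rightarrow> omega_plane.
     B \<in> borel_measurable (restrict_space borel omega_graphs) \<and>
     (\<forall>R\<in>omega_graphs. \<forall>e :: nat \<Rightarrow> 'a. inj e \<longrightarrow>
        realises (B R) (graph_plane (graph_of_omega e R)))"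
proof -
  let ?M = "restrict_space borel omega_graphs"
  let ?G = "\<lambda>R. graph_of_omega id R :: nat graph"
  define T where "T R a \<longleftrightarrow> decode a \<in> pts (?G R)" for R a
  define J where "J R a b c \<longleftrightarrow> a \<noteq> b \<and>
    (\<exists>l\<in>lines (graph_plane (?G R)). decode a \<in> l \<and> decode b \<in> l \<and> decode c \<in> l)" for R a b c
  have space: "space ?M = omega_graphs" by (simp add: space_restrict_space)
  have coord [measurable]: "Measurable.pred ?M (\<lambda>R. R (m, n))" for m n
    unfolding borel_measurable_bool[symmetric]
    by (intro measurable_restrict_space1 measurable_product_coordinates)
  have edge: "Measurable.pred ?M (\<lambda>R. s \<in> edges (?G R))" for s
    unfolding graph_of_omega_def by simp
  note [measurable] = edge
  have verts: "verts (?G R) = UNIV" for R by (simp add: graph_of_omega_def)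
  have point [measurable]: "Measurable.pred ?M (\<lambda>R. p \<in> pts (?G R))" for p
    by (cases p; simp only: in_pts verts) measurable
  have star [measurable]: "Measurable.pred ?M (\<lambda>R. p \<in> star (?G R) v)" for p v
    by (cases p; simp only: in_star) measurable
  have rail [measurable]: "Measurable.pred ?M (\<lambda>R. p \<in> rail (?G R) k)" for p k
    by (cases p; simp only: in_rail verts) measurable
  \<comment> \<open>Blocks are sets; indexing them by natural numbers leaves countable quantifiers
    only, which preserve measurability.\<close>
  have block: "(\<exists>l\<in>blocks (?G R). p \<in> l \<and> q \<in> l \<and> r \<in> l) \<longleftrightarrow>
      (\<exists>i<14. p \<in> strip i \<and> q \<in> strip i \<and> r \<in> strip i) \<or>
      (\<exists>k<3. p \<in> rail (?G R) k \<and> q \<in> rail (?G R) k \<and> r \<in> rail (?G R) k) \<or>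
      (\<exists>v. p \<in> star (?G R) v \<and> q \<in> star (?G R) v \<and> r \<in> star (?G R) v)" for p q r R
    unfolding blocks_def verts by (simp add: bex_Un) (simp add: Bex_def)
  have J_measurable: "Measurable.pred ?M (\<lambda>R. J R a b c)" for a b c
  proof (cases "a = b")
    case True
    then show ?thesis by (simp add: J_def)
  next
    case False
    then have "decode a \<noteq> decode b" using inj_decode by (simp add: inj_eq)
    then have J: "J R a b c \<longleftrightarrow> (\<exists>l\<in>blocks (?G R). decode a \<in> l \<and> decode b \<in> l \<and> decode c \<in> l) \<or>
        decode a \<in> pts (?G R) \<and> decode b \<in> pts (?G R) \<and> (decode c = decode a \<or> decode c = decode b)" for R
      using collinear_plane_of_blocks[of "blocks (?G R)" "pts (?G R)" "decode a" "decode b" "decode c", OF blocks_subset]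
        False by (simp add: J_def graph_plane_def)
    show ?thesis unfolding J block by measurable
  qed
  have G: "is_graph (?G R)" if "R \<in> omega_graphs" for R
    using is_graph_of_omega[OF that, of id] by simp
  have coded: "infinite (codes (T R) (J R))" "realises (coded_plane (T R) (J R)) (graph_plane (?G R))"
    if R: "R \<in> omega_graphs" for R
  proof -
    have "infinite (verts (?G R))" by (simp add: verts)
    then have "infinite (pts (?G R))" using eqpoll_pts[OF G[OF R]] eqpoll_finite_iff by blast
    then show "infinite (codes (T R) (J R))" "realises (coded_plane (T R) (J R)) (graph_plane (?G R))"
      using realises_coded_plane[OF is_plane_graph_plane[OF G[OF R]] inj_decode, of "T R" "J R"]
        pts_decode[OF G[OF R]] by (simp_all add: T_def J_def)
  qed
  show ?thesis
  proof (intro exI conjI ballI allI impI)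
    show "(\<lambda>R. coded_plane (T R) (J R)) \<in> borel_measurable ?M"
    proof (rule measurable_coded_plane)
      show "Measurable.pred ?M (\<lambda>R. T R a)" for a unfolding T_def by (rule point)
    qed (use J_measurable coded(1) space in auto)
    fix R and e :: "nat \<Rightarrow> 'a" assume R: "R \<in> omega_graphs" and e: "inj e"
    have "plane_iso (lift (inv_into UNIV e)) (image (lift (inv_into UNIV e)))
        (graph_plane (graph_of_omega e R)) (graph_plane (?G R))"
      using graph_iso_of_omega[OF e] is_graph_of_omega[OF R e] G[OF R] by (rule plane_iso_lift)
    then show "realises (coded_plane (T R) (J R)) (graph_plane (graph_of_omega e R))"
      using coded(2)[OF R] by (rule realises_iso)
  qed
qed

theorem theorem2:
  shows "\<exists>P :: 'a graph \<Rightarrow> ('a set \<times> nat) plane.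
    (\<forall>\<Gamma>. is_graph \<Gamma> \<longrightarrow> is_plane (P \<Gamma>)) \<and>
    (\<forall>\<Gamma>. is_graph \<Gamma> \<and> finite (verts \<Gamma>) \<longrightarrow>
       finite (points (P \<Gamma>)) \<and>
       card (points (P \<Gamma>)) = 3 * card (verts \<Gamma>) + card (edges \<Gamma>) + 17) \<and>
    (\<forall>\<Gamma>. is_graph \<Gamma> \<and> infinite (verts \<Gamma>) \<longrightarrow> points (P \<Gamma>) \<approx> verts \<Gamma>) \<and>
    (\<forall>\<Gamma>. is_graph \<Gamma> \<longrightarrow>
       (\<exists>X. X \<subseteq> points (P \<Gamma>) \<and> card X = 17 \<and>
         (\<forall>p\<in>points (P \<Gamma>) - X.
            finite (nontrivial_lines_through (P \<Gamma>) p) \<and>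
            card (nontrivial_lines_through (P \<Gamma>) p) \<le> 2))) \<and>
    (\<forall>\<Gamma>. is_graph \<Gamma> \<longrightarrow> Aut_graph \<Gamma> \<cong> Aut_plane (P \<Gamma>)) \<and>
    (\<forall>\<Gamma>\<^sub>1 \<Gamma>\<^sub>2. is_graph \<Gamma>\<^sub>1 \<and> is_graph \<Gamma>\<^sub>2 \<longrightarrow>
       (graphs_isomorphic \<Gamma>\<^sub>1 \<Gamma>\<^sub>2 \<longleftrightarrow> planes_isomorphic (P \<Gamma>\<^sub>1) (P \<Gamma>\<^sub>2))) \<and>
    (\<exists>B :: omega_graph \<Rightarrow> omega_plane.
       B \<in> borel_measurable (restrict_space borel omega_graphs) \<and>
       (\<forall>R\<in>omega_graphs. \<forall>e :: nat \<Rightarrow> 'a. inj e \<longrightarrow>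
          realises (B R) (P (graph_of_omega e R))))"
proof (intro exI[of _ graph_plane] conjI allI impI)
  fix G H :: "'a graph"
  show "is_plane (graph_plane G)" if "is_graph G"
    using that by (rule is_plane_graph_plane)
  show "finite (points (graph_plane G))"
    "card (points (graph_plane G)) = 3 * card (verts G) + card (edges G) + 17"
    if "is_graph G \<and> finite (verts G)"
    using that card_pts[of G] by simp_all
  show "points (graph_plane G) \<approx> verts G" if "is_graph G \<and> infinite (verts G)"
    using that eqpoll_pts[of G] by simp
  show "\<exists>X. X \<subseteq> points (graph_plane G) \<and> card X = 17 \<and>
         (\<forall>p\<in>points (graph_plane G) - X.
            finite (nontrivial_lines_through (graph_plane G) p) \<and>
            card (nontrivial_lines_through (graph_plane G) p) \<le> 2)" if "is_graph G"
    using that by (rule few_nontrivial_lines)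
  show "Aut_graph G \<cong> Aut_plane (graph_plane G)" if "is_graph G"
    using that by (rule Aut_graph_iso_Aut_plane)
  show "graphs_isomorphic G H \<longleftrightarrow> planes_isomorphic (graph_plane G) (graph_plane H)"
    if "is_graph G \<and> is_graph H"
    using that by (intro graphs_isomorphic_iff) simp_all
qed (rule borel_realisation)

end
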